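(* Let $s>0$ be a fixed real number. Let $\overline{\mathcal H}_0=\mathcal P_{0,[0,1]^3}$. Suppose that $\mathcal H_0$ is either $\mathcal P_{0,[0,1]^3,\mathrm{TV}}(L)$ or $\mathcal P_{0,[0,1]^3,\chi^2}(L)$, and $\mathcal H_1=\mathcal Q_{0,[0,1]^3,\mathrm{TV}}(L,s)$, for some fixed $L\in\mathbb R^+$. Then for some absolute constant $c_0>0$, $$\varepsilon_n(\mathcal H_0,\overline{\mathcal H}_0,\mathcal H_1)\ \ge\ \frac{c_0}{n^{2s/(5s+2)}}.$$
   Context: Notation: for distributions $p,q$ with densities with respect to a common dominating measure $\nu$, $\|p-q\|_1=\int|\frac{dp}{d\nu}-\frac{dq}{d\nu}|d\nu$; $d_{\chi^2}(p,q)=\int(\frac{dp}{dq}-1)^2dq$ if $p\ll q$, and $d_{\chi^2}(p,q)=\infty$ otherwise. $\mathcal E_{0,[0,1]^3}$ is the set of distributions $p=p_{X,Y,Z}$ of triples of real random variables $(X,Y,Z)$ supported on $[0,1]^3$ and absolutely continuous with respect to Lebesgue measure. $\mathcal P_{0,[0,1]^3}\subset\mathcal E_{0,[0,1]^3}$ is the subset of distributions for which $X$ and $Y$ are conditionally independent given $Z$, and $\mathcal Q_{0,[0,1]^3}=\mathcal E_{0,[0,1]^3}\setminus\mathcal P_{0,[0,1]^3}$. Below, $p_{X|Z=z}$, $p_{Y|Z=z}$ and $p_{X,Y|Z=z}$ denote the conditional distributions of $X$, $Y$ and $(X,Y)$ given $Z=z$ under $p_{X,Y,Z}$, and $p_{X,Y|Z}(x,y|z)$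 denotes the conditional density. - $\mathcal P_{0,[0,1]^3,\mathrm{TV}}(L)$: those $p\in\mathcal P_{0,[0,1]^3}$ with $\|p_{X|Z=z}-p_{X|Z=z'}\|_1\le L|z-z'|$ and $\|p_{Y|Z=z}-p_{Y|Z=z'}\|_1\le L|z-z'|$ for all $z,z'\in[0,1]$. - $\mathcal P_{0,[0,1]^3,\chi^2}(L)$: those $p\in\mathcal P_{0,[0,1]^3}$ with $d_{\chi^2}(p_{X|Z=z},p_{X|Z=z'})\le L|z-z'|$ and $d_{\chi^2}(p_{Y|Z=z},p_{Y|Z=z'})\le L|z-z'|$ for all $z,z'\in[0,1]$. - Hölder class: for $s>0$ let $\lfloor s\rfloor$ denote the largest integer strictly smaller than $s$. $\mathcal H^{2,s}(L)$ is the class of functions $f:[0,1]^2\to\mathbb R$ possessing all partial derivatives up to order $\lfloor s\rfloor$ and such that for all $x,y,x',y'\in[0,1]$ $$\sup_{k\le\lfloor s\rfloor}\Big|\tfrac{\partial^k}{\partial x^k}\tfrac{\partial^{\lfloor s\rfloor-k}}{\partial y^{\lfloor s\rfloor-k}}f(x,y)-\tfrac{\partial^k}{\partial x^k}\tfrac{\partial^{\lfloor s\rfloor-k}}{\partial y^{\lfloor s\rfloor-k}}f(x',y')\Big|\le L\big((x-x')^2+(y-y')^2\big)^{\frac{s-\lfloor s\rfloor}{2}}$$ and $\sup_{k\le\lfloor s\rfloor}\big|\tfrac{\partial^k}{\partial x^k}\tfrac{\partial^{\lfloor s\rfloor-k}}{\partial y^{\lfloor s\rfloor-k}}f(x,y)\big|\le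 L$, where $k$ ranges over integers $0\le k\le\lfloor s\rfloor$. - $\mathcal Q_{0,[0,1]^3,\mathrm{TV}}(L,s)$: those $p\in\mathcal Q_{0,[0,1]^3}$ with $\|p_{X,Y|Z=z}-p_{X,Y|Z=z'}\|_1\le L|z-z'|$ for all $z,z'\in[0,1]$, and such that for every $z\in[0,1]$ the conditional density $(x,y)\mapsto p_{X,Y|Z}(x,y|z)$ belongs to $\mathcal H^{2,s}(L)$. Minimax testing: for sets of distributions $\mathcal H_0\subseteq\overline{\mathcal H}_0$ and $\mathcal H_1$, let $\mathcal S_1(\varepsilon)=\{p\in\mathcal H_1:\inf_{q\in\overline{\mathcal H}_0}\|p-q\|_1\ge\varepsilon\}$ and $$R_n(\mathcal H_0,\overline{\mathcal H}_0,\mathcal H_1,\varepsilon)=\inf_\psi\Big\{\sup_{p\in\mathcal H_0}\mathbb E_p[\psi(\mathcal D_n)]+\sup_{p\in\mathcal S_1(\varepsilon)}\mathbb E_p[1-\psi(\mathcal D_n)]\Big\},$$ where $\mathcal D_n$ consists of $n$ i.i.d. observations $(X_i,Y_i,Z_i)\sim p$ and the infimum is over all Borel measurable test functions $\psi$ of the data with values in $[0,1]$. The critical radius is $\varepsilon_n(\mathcal H_0,\overline{\mathcal H}_0,\mathcal H_1)=\inf\{\varepsilon: R_n(\mathcal H_0,\overline{\mathcal H}_0,\mathcal H_1,\varepsilon)\le \tfrac13\}$.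
   Formalization: The class H1 is assumed nonempty: for s ≤ 1 and L ≤ 1 no such alternative exists, the test ψ = 0 has zero risk, the critical radius is 0 and the bound fails. The constant c0 is independent of n but may depend on the fixed s and L. *)

theory Defs
  imports "HOL-Probability.Probability"
begin

subsection \<open>Distances between distributions\<close>

definition sum_measure :: "'a measure \<Rightarrow> 'a measure \<Rightarrow> 'a measure" where
  "sum_measure p q = measure_of (space p) (sets p) (\<lambda>A. emeasure p A + emeasure q A)"

(* The value does not depend on the choice of the common dominating measure; p + q always is one. *)
definition l1_dist :: "'a measure \<Rightarrow> 'a measure \<Rightarrow> ennreal" where
  "l1_dist p q =
     (let \<nu> = sum_measure p q
      in \<integral>\<^sup>+x. ennreal \<bar>enn2real (RN_deriv \<nu> p x) - enn2real (RN_deriv \<nu> q x)\<bar> \<partial>\<nu>)"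

(* In the library, absolutely_continuous q p says p << q. *)
definition chi2_div :: "'a measure \<Rightarrow> 'a measure \<Rightarrow> ennreal" where
  "chi2_div p q =
     (if absolutely_continuous q p
      then \<integral>\<^sup>+x. ennreal ((enn2real (RN_deriv q p x) - 1)\<^sup>2) \<partial>q
      else \<infinity>)"

subsection \<open>Conditional distributions\<close>

type_synonym triple = "real \<times> real \<times> real"

abbreviation X_of :: "triple \<Rightarrow> real" where "X_of \<equiv> \<lambda>(x, y, z). x"
abbreviation Y_of :: "triple \<Rightarrow> real" where "Y_of \<equiv> \<lambda>(x, y, z). y"
abbreviation Z_of :: "triple \<Rightarrow> real" where "Z_of \<equiv> \<lambda>(x, y, z). z"
abbreviation XY_of :: "triple \<Rightarrow> real \<times> real" where "XY_of \<equiv> \<lambda>(x, y, z). (x, y)"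

(* The Markov kernel \<kappa> is a version of the conditional distribution of W given Z under p.
   Versions agree only up to a null set of the law of Z.  Conditions on the conditional
   distributions at every z are therefore required below of some version. *)
definition cond_distr ::
  "triple measure \<Rightarrow> (triple \<Rightarrow> 'b::topological_space) \<Rightarrow> (real \<Rightarrow> 'b measure) \<Rightarrow> bool" where
  "cond_distr p W \<kappa> \<longleftrightarrow>
     \<kappa> \<in> borel \<rightarrow>\<^sub>M prob_algebra borel \<and>
     (\<forall>A\<in>sets borel. \<forall>B\<in>sets borel.
        emeasure p {\<omega> \<in> space p. W \<omega> \<in> A \<and> Z_of \<omega> \<in> B} =
        (\<integral>\<^sup>+z\<in>B. emeasure (\<kappa> z) A \<partial>distr p borel Z_of))"

definition cond_indep_XY_given_Z :: "triple measure \<Rightarrow> bool" where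
  "cond_indep_XY_given_Z p \<longleftrightarrow>
     (\<exists>\<kappa>X \<kappa>Y. cond_distr p X_of \<kappa>X \<and> cond_distr p Y_of \<kappa>Y \<and>
        cond_distr p XY_of (\<lambda>z. \<kappa>X z \<Otimes>\<^sub>M \<kappa>Y z))"

subsection \<open>Classes of distributions\<close>

definition E0 :: "triple measure set" where
  "E0 = {p. prob_space p \<and> sets p = sets borel \<and>
            emeasure p ({0..1} \<times> {0..1} \<times> {0..1}) = 1 \<and> absolutely_continuous lborel p}"

definition P0 :: "triple measure set" where
  "P0 = {p \<in> E0. cond_indep_XY_given_Z p}"

definition Q0 :: "triple measure set" where
  "Q0 = E0 - P0"

definition P0_TV :: "real \<Rightarrow> triple measure set" where
  "P0_TV L = {p \<in> P0. \<exists>\<kappa>X \<kappa>Y. cond_distr p X_of \<kappa>X \<and> cond_distr p Y_of \<kappa>Y \<and>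
     (\<forall>z\<in>{0..1}. \<forall>z'\<in>{0..1}.
        l1_dist (\<kappa>X z) (\<kappa>X z') \<le> ennreal (L * \<bar>z - z'\<bar>) \<and>
        l1_dist (\<kappa>Y z) (\<kappa>Y z') \<le> ennreal (L * \<bar>z - z'\<bar>))}"

definition P0_chi2 :: "real \<Rightarrow> triple measure set" where
  "P0_chi2 L = {p \<in> P0. \<exists>\<kappa>X \<kappa>Y. cond_distr p X_of \<kappa>X \<and> cond_distr p Y_of \<kappa>Y \<and>
     (\<forall>z\<in>{0..1}. \<forall>z'\<in>{0..1}.
        chi2_div (\<kappa>X z) (\<kappa>X z') \<le> ennreal (L * \<bar>z - z'\<bar>) \<and>
        chi2_div (\<kappa>Y z) (\<kappa>Y z') \<le> ennreal (L * \<bar>z - z'\<bar>))}"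

(* The largest integer strictly smaller than s, for s > 0; so 0 for s = 1. *)
definition strict_floor :: "real \<Rightarrow> nat" where
  "strict_floor s = nat (\<lceil>s\<rceil> - 1)"

(* D k m is the partial derivative of order k in x and m in y.  Derivatives are one-sided on the
   boundary of the square.  D is unique on the square, and asking that both ways of reaching
   D (Suc k) (Suc m) give the same function is no restriction: the top-order derivatives are
   (Hoelder) continuous, so mixed partial derivatives commute. *)
definition holder2 :: "real \<Rightarrow> real \<Rightarrow> (real \<Rightarrow> real \<Rightarrow> real) \<Rightarrow> bool" where
  "holder2 s L f \<longleftrightarrow>
     (\<exists>D :: nat \<Rightarrow> nat \<Rightarrow> real \<Rightarrow> real \<Rightarrow> real.
        (\<forall>x\<in>{0..1}. \<forall>y\<in>{0..1}. D 0 0 x y = f x y) \<and>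
        (\<forall>k m. k + m < strict_floor s \<longrightarrow> (\<forall>x\<in>{0..1}. \<forall>y\<in>{0..1}.
           ((\<lambda>t. D k m t y) has_real_derivative D (Suc k) m x y) (at x within {0..1}) \<and>
           ((\<lambda>t. D k m x t) has_real_derivative D k (Suc m) x y) (at y within {0..1}))) \<and>
        (\<forall>k\<le>strict_floor s. \<forall>x\<in>{0..1}. \<forall>y\<in>{0..1}. \<forall>x'\<in>{0..1}. \<forall>y'\<in>{0..1}.
           \<bar>D k (strict_floor s - k) x y - D k (strict_floor s - k) x' y'\<bar>
             \<le> L * ((x - x')\<^sup>2 + (y - y')\<^sup>2) powr ((s - real (strict_floor s)) / 2)) \<and>
        (\<forall>k\<le>strict_floor s. \<forall>x\<in>{0..1}. \<forall>y\<in>{0..1}.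
           \<bar>D k (strict_floor s - k) x y\<bar> \<le> L))"

definition Q0_TV :: "real \<Rightarrow> real \<Rightarrow> triple measure set" where
  "Q0_TV L s = {p \<in> Q0. \<exists>\<kappa>. cond_distr p XY_of \<kappa> \<and>
     (\<forall>z\<in>{0..1}. \<forall>z'\<in>{0..1}. l1_dist (\<kappa> z) (\<kappa> z') \<le> ennreal (L * \<bar>z - z'\<bar>)) \<and>
     (\<forall>z\<in>{0..1}. \<exists>f. holder2 s L f \<and> (\<forall>x\<in>{0..1}. \<forall>y\<in>{0..1}. 0 \<le> f x y) \<and>
        \<kappa> z = density lborel
          (\<lambda>(x, y). ennreal (f x y) * indicator ({0..1} \<times> {0..1}) (x, y)))}"

subsection \<open>Minimax testing\<close>

definition tests :: "nat \<Rightarrow> ((nat \<Rightarrow> triple) \<Rightarrow> real) set" where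
  "tests n = {\<psi> \<in> borel_measurable (\<Pi>\<^sub>M i\<in>{..<n}. borel).
     \<forall>\<omega>\<in>space (\<Pi>\<^sub>M i\<in>{..<n}. (borel :: triple measure)). \<psi> \<omega> \<in> {0..1}}"

definition S1 :: "triple measure set \<Rightarrow> triple measure set \<Rightarrow> ennreal \<Rightarrow> triple measure set" where
  "S1 H0bar H1 \<epsilon> = {p \<in> H1. \<epsilon> \<le> (INF q\<in>H0bar. l1_dist p q)}"

(* Over ennreal a supremum over an empty set of distributions is 0. *)
definition minimax_risk ::
  "nat \<Rightarrow> triple measure set \<Rightarrow> triple measure set \<Rightarrow> triple measure set \<Rightarrow> ennreal \<Rightarrow> ennreal" where
  "minimax_risk n H0 H0bar H1 \<epsilon> =
     (INF \<psi>\<in>tests n.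
        (SUP p\<in>H0. \<integral>\<^sup>+\<omega>. ennreal (\<psi> \<omega>) \<partial>(\<Pi>\<^sub>M i\<in>{..<n}. p)) +
        (SUP p\<in>S1 H0bar H1 \<epsilon>. \<integral>\<^sup>+\<omega>. ennreal (1 - \<psi> \<omega>) \<partial>(\<Pi>\<^sub>M i\<in>{..<n}. p)))"

definition critical_radius ::
  "nat \<Rightarrow> triple measure set \<Rightarrow> triple measure set \<Rightarrow> triple measure set \<Rightarrow> ennreal" where
  "critical_radius n H0 H0bar H1 = Inf {\<epsilon>. minimax_risk n H0 H0bar H1 \<epsilon> \<le> 1 / 3}"

end

(* Let u be the uniform distribution on the cube, which lies in both null classes.  Cut the cube into
   m * m * k boxes and perturb the density 1 of u on each box by +a or -a times a product of three
   smooth bumps of mean zero that vanish to high order on the faces of the box; let p_A be the law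
   obtained when the boxes with sign + are those in A.  Smoothness of order s in (x, y) only requires
   a * m^s = O(1), and the Lipschitz condition in z only requires a * k = O(1).

   Every q in P0 is at distance at least a constant times a from p_A.  Write h for the density
   1 + perturbation / a and average h over the conditional distribution of Y under q: by conditional
   independence this does not change its expectation under q, but the resulting function of (X, Z) has
   expectation 1 under p_A, whereas h itself has expectation 1 + constant * a.

   On the other hand the uniform mixture over A of the n-fold products of p_A has chi-square distance
   at most exp (n^2 a^4 / (m^2 k)) - 1 from the n-fold product of u.  Taking a of order n^(-2s/(5s+2)),
   k of order 1/a and m of order a^(-1/s) keeps this small. *)

theory Submission
  imports Defs
begin

subsection \<open>Distances and conditional distributions\<close>

text \<open>One periodic function on the line serves every box: after rescaling it vanishes, with
  its derivatives, at the integers, so a sign that depends on the floor of the coordinates may jump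
  there without harming smoothness. Its mean is zero because it is itself the derivative of a
  periodic function. Mean zero acts three times: it keeps the conditional densities normalised, it
  kills the terms linear in the amplitude when two perturbed densities are multiplied, and it fixes
  the expectation of the averaged \<open>h\<close> under p_A.

  Random signs are what makes the mixture hard to detect: the overlap of two sign patterns is a
  Rademacher sum over m^2 k boxes, so its moment generating function sees n a^2 / (m^2 k) only
  through its square times the number of boxes.

  For s <= 1 the Hoelder condition bounds the density itself by L, and a probability density on the
  unit square bounded by some L <= 1 is uniform. The alternative class is then empty and the
  critical radius is 0; this is why nonemptiness is assumed, and why the constant depends on the
  margin L - 1.\<close>

lemma
  shows space_sum_measure [simp]: "space (sum_measure p q) = space p"
    and sets_sum_measure [simp, measurable_cong]: "sets (sum_measure p q) = sets p"
  by (simp_all add: sum_measure_def)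

lemma emeasure_sum_measure:
  assumes "sets q = sets p" "A \<in> sets p"
  shows "emeasure (sum_measure p q) A = emeasure p A + emeasure q A"
  unfolding sum_measure_def
proof (rule emeasure_measure_of_sigma)
  show "sigma_algebra (space p) (sets p)" ..
  show "positive (sets p) (\<lambda>A. emeasure p A + emeasure q A)"
    by (simp add: positive_def)
  show "countably_additive (sets p) (\<lambda>A. emeasure p A + emeasure q A)"
    using assms(1)
    by (auto simp: countably_additive_def suminf_emeasure simp flip: suminf_add)
qed fact

lemma
  assumes "finite_measure p" "finite_measure q" "sets q = sets p"
  shows finite_sum_measure: "finite_measure (sum_measure p q)"
    and absolutely_continuous_sum_measure1: "absolutely_continuous (sum_measure p q) p"
    and absolutely_continuous_sum_measure2: "absolutely_continuous (sum_measure p q) q"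
proof -
  interpret p: finite_measure p by fact
  interpret q: finite_measure q by fact
  have "emeasure q (space p) \<noteq> \<infinity>" by simp
  then show "finite_measure (sum_measure p q)"
    by (intro finite_measureI) (simp add: emeasure_sum_measure assms)
  show "absolutely_continuous (sum_measure p q) p" "absolutely_continuous (sum_measure p q) q"
    using assms(3) by (auto simp: absolutely_continuous_def null_sets_def emeasure_sum_measure)
qed

text \<open>Written against \<open>sum_measure p q\<close>, the two integrands differ by at most |P
  - Q| times \<open>h\<close>, and \<open>h \<le> 2\<close> produces the factor 2. Both directions
  refer to the same \<open>l1_dist p q\<close>, so symmetry of the distance is not invoked
  later.\<close>

lemma nn_integral_le_l1_dist:
  assumes "finite_measure p" "finite_measure q" "sets q = sets p"
    and [measurable]: "h \<in> borel_measurable p"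
    and h: "\<And>x. x \<in> space p \<Longrightarrow> h x \<le> 2"
  shows "(\<integral>\<^sup>+x. h x \<partial>p) \<le> (\<integral>\<^sup>+x. h x \<partial>q) + 2 * l1_dist p q"
    and "(\<integral>\<^sup>+x. h x \<partial>q) \<le> (\<integral>\<^sup>+x. h x \<partial>p) + 2 * l1_dist p q"
proof -
  define \<nu> where "\<nu> = sum_measure p q"
  interpret p: finite_measure p by fact
  interpret q: finite_measure q by fact
  interpret \<nu>: finite_measure \<nu> unfolding \<nu>_def using assms(1-3) by (rule finite_sum_measure)
  note sets [simp, measurable_cong] = sets_sum_measure[of p q, folded \<nu>_def]
  have ac: "absolutely_continuous \<nu> p" "absolutely_continuous \<nu> q"
    unfolding \<nu>_def using assms(1-3)
    by (rule absolutely_continuous_sum_measure1 absolutely_continuous_sum_measure2)+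
  define P where "P x = enn2real (RN_deriv \<nu> p x)" for x
  define Q where "Q x = enn2real (RN_deriv \<nu> q x)" for x
  have [measurable]: "P \<in> borel_measurable \<nu>" "Q \<in> borel_measurable \<nu>"
    unfolding P_def Q_def by measurable
  \<comment> \<open>\<open>enn2real\<close> loses nothing here: the derivative of a finite measure
    is finite almost everywhere.\<close>
  have AEP: "AE x in \<nu>. RN_deriv \<nu> p x = ennreal (P x)"
    using \<nu>.RN_deriv_finite[OF _ ac(1)] p.sigma_finite_measure_axioms
    by (auto simp: P_def less_top)
  have AEQ: "AE x in \<nu>. RN_deriv \<nu> q x = ennreal (Q x)"
    using \<nu>.RN_deriv_finite[OF _ ac(2)] q.sigma_finite_measure_axioms assms(3)
    by (auto simp: Q_def less_top)
  have ip: "(\<integral>\<^sup>+x. h x \<partial>p) = (\<integral>\<^sup>+x. ennreal (P x) * h x \<partial>\<nu>)"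
    using AEP by (subst \<nu>.RN_deriv_nn_integral[OF ac(1)]) (auto intro!: nn_integral_cong_AE)
  have iq: "(\<integral>\<^sup>+x. h x \<partial>q) = (\<integral>\<^sup>+x. ennreal (Q x) * h x \<partial>\<nu>)"
    using AEQ assms(3) by (subst \<nu>.RN_deriv_nn_integral[OF ac(2)]) (auto intro!: nn_integral_cong_AE)
  have l1: "l1_dist p q = (\<integral>\<^sup>+x. ennreal \<bar>P x - Q x\<bar> \<partial>\<nu>)"
    unfolding l1_dist_def Let_def P_def Q_def \<nu>_def by simp
  have pt: "ennreal a * t \<le> ennreal b * t + 2 * ennreal \<bar>a - b\<bar>" if "t \<le> 2" "0 \<le> a" "0 \<le> b" for a b t
  proof -
    have "ennreal a * t \<le> (ennreal b + ennreal \<bar>a - b\<bar>) * t"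
      using that by (intro mult_right_mono) (auto simp flip: ennreal_plus intro!: ennreal_leI)
    also have "\<dots> \<le> ennreal b * t + 2 * ennreal \<bar>a - b\<bar>"
      using mult_right_mono[OF that(1), of "ennreal \<bar>a - b\<bar>"]
      by (subst distrib_right) (intro add_left_mono, simp add: mult.commute)
    finally show ?thesis .
  qed
  have PQ: "0 \<le> P x" "0 \<le> Q x" for x by (auto simp: P_def Q_def)
  have sp: "space \<nu> = space p" by (simp add: \<nu>_def)
  show "(\<integral>\<^sup>+x. h x \<partial>p) \<le> (\<integral>\<^sup>+x. h x \<partial>q) + 2 * l1_dist p q"
    unfolding ip iq l1 by (subst nn_integral_cmult[symmetric], measurable, subst nn_integral_add[symmetric])
      (auto intro!: nn_integral_mono pt h PQ simp: sp)
  show "(\<integral>\<^sup>+x. h x \<partial>q) \<le> (\<integral>\<^sup>+x. h x \<partial>p) + 2 * l1_dist p q"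
    unfolding ip iq l1 abs_minus_commute[of "P _"]
    by (subst nn_integral_cmult[symmetric], measurable, subst nn_integral_add[symmetric])
      (auto intro!: nn_integral_mono pt h PQ simp: sp)
qed

lemma l1_dist_self [simp]: "l1_dist p p = 0"
  by (simp add: l1_dist_def)

lemma chi2_div_self:
  assumes "finite_measure p"
  shows "chi2_div p p = 0"
proof -
  interpret finite_measure p by fact
  have "AE x in p. 1 = RN_deriv p p x"
    by (rule RN_deriv_unique) (auto simp: density_1)
  then have "AE x in p. ennreal ((enn2real (RN_deriv p p x) - 1)\<^sup>2) = 0"
    by eventually_elim (metis diff_self enn2real_1 ennreal_0 zero_power2)
  then have "(\<integral>\<^sup>+x. ennreal ((enn2real (RN_deriv p p x) - 1)\<^sup>2) \<partial>p) = 0"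
    by (subst nn_integral_0_iff_AE) auto
  then show ?thesis by (simp add: chi2_div_def absolutely_continuous_def)
qed

text \<open>The sum of the two measures has density \<open>f + g\<close>, so the Radon-Nikodym
  derivatives in \<open>l1_dist\<close> are f/(f+g) and g/(f+g), and the factor f+g cancels on
  returning to \<open>M\<close>.\<close>

lemma l1_dist_density_le:
  assumes [measurable]: "f \<in> borel_measurable M" "g \<in> borel_measurable M"
    and nonneg: "\<And>x. 0 \<le> f x" "\<And>x. 0 \<le> g x"
    and fin: "finite_measure (density M (\<lambda>x. ennreal (f x)))" "finite_measure (density M (\<lambda>x. ennreal (g x)))"
  shows "l1_dist (density M (\<lambda>x. ennreal (f x))) (density M (\<lambda>x. ennreal (g x)))
    \<le> (\<integral>\<^sup>+x. ennreal \<bar>f x - g x\<bar> \<partial>M)"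
proof -
  let ?p = "density M (\<lambda>x. ennreal (f x))" and ?q = "density M (\<lambda>x. ennreal (g x))"
  define \<nu> where "\<nu> = sum_measure ?p ?q"
  have \<nu>: "\<nu> = density M (\<lambda>x. ennreal (f x + g x))"
    unfolding \<nu>_def
    by (rule measure_eqI)
      (auto simp: emeasure_sum_measure emeasure_density distrib_right nonneg simp flip: nn_integral_add)
  interpret \<nu>: finite_measure \<nu> unfolding \<nu>_def using fin by (intro finite_sum_measure) auto
  have sets_\<nu> [simp, measurable_cong]: "sets \<nu> = sets M" by (simp add: \<nu>)
  define F where "F x = f x / (f x + g x)" for x
  define G where "G x = g x / (f x + g x)" for x
  have [measurable]: "F \<in> borel_measurable M" "G \<in> borel_measurable M"
    unfolding F_def G_def by measurable
  \<comment> \<open>Where \<open>f x + g x = 0\<close> both densities vanish, which agrees with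
    division by zero giving 0.\<close>
  have F: "(f x + g x) * F x = f x" and G: "(f x + g x) * G x = g x" for x
    using nonneg[of x] by (auto simp: F_def G_def add_nonneg_eq_0_iff)
  have nn: "0 \<le> F x" "0 \<le> G x" for x using nonneg[of x] by (auto simp: F_def G_def)
  have "density \<nu> (\<lambda>x. ennreal (F x)) = ?p"
    unfolding \<nu> by (subst density_density_eq) (auto simp: F nn nonneg simp del: ennreal_plus simp flip: ennreal_mult intro!: density_cong)
  then have AEF: "AE x in \<nu>. ennreal (F x) = RN_deriv \<nu> ?p x"
    by (intro \<nu>.RN_deriv_unique) auto
  have "density \<nu> (\<lambda>x. ennreal (G x)) = ?q"
    unfolding \<nu> by (subst density_density_eq) (auto simp: G nn nonneg simp del: ennreal_plus simp flip: ennreal_mult intro!: density_cong)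
  then have AEG: "AE x in \<nu>. ennreal (G x) = RN_deriv \<nu> ?q x"
    by (intro \<nu>.RN_deriv_unique) auto
  have "l1_dist ?p ?q = (\<integral>\<^sup>+x. ennreal \<bar>enn2real (RN_deriv \<nu> ?p x) - enn2real (RN_deriv \<nu> ?q x)\<bar> \<partial>\<nu>)"
    by (simp add: l1_dist_def \<nu>_def Let_def)
  also have "\<dots> = (\<integral>\<^sup>+x. ennreal \<bar>F x - G x\<bar> \<partial>\<nu>)"
    using AEF AEG
    by (intro nn_integral_cong_AE, eventually_elim) (metis enn2real_ennreal nn)
  also have "\<dots> = (\<integral>\<^sup>+x. ennreal (f x + g x) * ennreal \<bar>F x - G x\<bar> \<partial>M)"
    unfolding \<nu> by (subst nn_integral_density) auto
  also have "\<dots> = (\<integral>\<^sup>+x. ennreal \<bar>f x - g x\<bar> \<partial>M)"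
  proof (rule nn_integral_cong)
    fix x
    have "(f x + g x) * \<bar>F x - G x\<bar> = \<bar>(f x + g x) * (F x - G x)\<bar>"
      using nonneg[of x] by (simp add: abs_mult)
    then have "(f x + g x) * \<bar>F x - G x\<bar> = \<bar>f x - g x\<bar>"
      by (simp add: right_diff_distrib F G)
    then show "ennreal (f x + g x) * ennreal \<bar>F x - G x\<bar> = ennreal \<bar>f x - g x\<bar>"
      using nonneg[of x] by (simp del: ennreal_plus flip: ennreal_mult)
  qed
  finally show ?thesis by simp
qed

text \<open>\<open>cond_distr\<close> speaks of rectangles only. These form an intersection-stable
  generator, so the joint law of \<open>W\<close> and Z is the law of Z followed by the kernel, and
  the identity passes to integrals. Measurability of \<open>h\<close> refers to the product
  sigma-algebra, since for a general topological space the Borel sets of the product may be more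
  numerous.\<close>

lemma nn_integral_cond_distr:
  assumes "prob_space p" and sp: "sets p = sets borel" and W: "W \<in> p \<rightarrow>\<^sub>M borel"
    and c: "cond_distr p W \<kappa>" and h: "h \<in> borel_measurable (borel \<Otimes>\<^sub>M borel)"
  shows "(\<integral>\<^sup>+\<omega>. h (W \<omega>, Z_of \<omega>) \<partial>p)
    = (\<integral>\<^sup>+z. (\<integral>\<^sup>+w. h (w, z) \<partial>\<kappa> z) \<partial>distr p borel Z_of)"
proof -
  interpret prob_space p by fact
  note sp[measurable_cong] W[measurable] h[measurable]
  have \<kappa>: "\<kappa> \<in> borel \<rightarrow>\<^sub>M prob_algebra borel"
    and eq: "\<And>A B. A \<in> sets borel \<Longrightarrow> B \<in> sets borel \<Longrightarrow>
        emeasure p {\<omega> \<in> space p. W \<omega> \<in> A \<and> Z_of \<omega> \<in> B} =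
        (\<integral>\<^sup>+z\<in>B. emeasure (\<kappa> z) A \<partial>distr p borel Z_of)"
    using c by (auto simp: cond_distr_def)
  have \<kappa>'[measurable]: "\<kappa> \<in> borel \<rightarrow>\<^sub>M subprob_algebra borel"
    using \<kappa> by (rule measurable_prob_algebraD)
  have Z[measurable]: "Z_of \<in> p \<rightarrow>\<^sub>M borel"
  proof -
    have "Z_of \<in> (borel \<Otimes>\<^sub>M (borel \<Otimes>\<^sub>M borel)) \<rightarrow>\<^sub>M borel" by measurable
    then show ?thesis by (simp add: borel_prod measurable_cong_sets[OF sp refl])
  qed
  define N where "N = distr p borel Z_of"
  have [simp, measurable_cong]: "sets N = sets borel" by (simp add: N_def)
  interpret N: prob_space N unfolding N_def by (rule prob_space_distr) simp
  have sk: "sets (\<kappa> z) = sets borel" for z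
    using measurable_space[OF \<kappa>', of z] by (simp add: space_subprob_algebra)
  have pk: "prob_space (\<kappa> z)" for z
    using measurable_space[OF \<kappa>, of z] by (simp add: space_prob_algebra)
  note sk[measurable_cong]
  \<comment> \<open>\<open>?M1\<close> is the joint law; \<open>?M2\<close> is the two-stage
    experiment that draws z from \<open>N\<close> and then w from the kernel at z.\<close>
  let ?M1 = "distr p (borel \<Otimes>\<^sub>M borel) (\<lambda>\<omega>. (W \<omega>, Z_of \<omega>))"
  let ?K = "\<lambda>z. distr (\<kappa> z) (borel \<Otimes>\<^sub>M borel) (\<lambda>w. (w, z))"
  let ?M2 = "bind N ?K"
  have K[measurable]: "?K \<in> N \<rightarrow>\<^sub>M subprob_algebra (borel \<Otimes>\<^sub>M borel)"
    by (rule measurable_distr2[where M=borel]) measurable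
  have pm: "\<And>z. (\<lambda>w. (w, z)) \<in> \<kappa> z \<rightarrow>\<^sub>M borel \<Otimes>\<^sub>M borel" by measurable
  have sM2: "sets ?M2 = sets (borel \<Otimes>\<^sub>M borel)"
    by (rule sets_bind) (auto simp: N.not_empty)
  have eqM: "?M1 = ?M2"
  proof (rule measure_eqI_generator_eq[where \<Omega>=UNIV and E="{A \<times> B | A B. A \<in> sets borel \<and> B \<in> sets borel}" and A="\<lambda>_. UNIV"])
    show "Int_stable {A \<times> B |A B. A \<in> sets borel \<and> B \<in> sets borel}" by (rule Int_stable_pair_measure_generator)
    show "sets ?M1 = sigma_sets UNIV {A \<times> B |A B. A \<in> sets borel \<and> B \<in> sets borel}"
      by (simp add: sets_pair_measure)
    then show "sets ?M2 = sigma_sets UNIV {A \<times> B |A B. A \<in> sets borel \<and> B \<in> sets borel}"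
      using sM2 by (simp add: sets_pair_measure)
    fix X assume "X \<in> {A \<times> B |A B. A \<in> (sets borel :: 'a set set) \<and> B \<in> (sets borel :: real set set)}"
    then obtain A B where X: "X = A \<times> B" and [measurable]: "A \<in> sets borel" "B \<in> sets borel" by auto
    have XM[measurable]: "X \<in> sets (borel \<Otimes>\<^sub>M borel)" unfolding X by measurable
    have "emeasure ?M1 X = emeasure p {\<omega> \<in> space p. W \<omega> \<in> A \<and> Z_of \<omega> \<in> B}"
      by (subst emeasure_distr) (auto simp: X intro!: arg_cong[where f="emeasure p"])
    also have "\<dots> = (\<integral>\<^sup>+z\<in>B. emeasure (\<kappa> z) A \<partial>N)" by (simp add: eq N_def)
    also have "\<dots> = (\<integral>\<^sup>+z. emeasure (?K z) X \<partial>N)"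
    proof (rule nn_integral_cong)
      fix z
      have "(\<lambda>w. (w, z)) -` X \<inter> space (\<kappa> z) = (if z \<in> B then A else {})"
        using sets_eq_imp_space_eq[OF sk, of z] by (auto simp: X)
      then show "emeasure (\<kappa> z) A * indicator B z = emeasure (?K z) X"
        by (simp add: emeasure_distr[OF pm XM])
    qed
    also have "\<dots> = emeasure ?M2 X"
      by (rule emeasure_bind[OF N.not_empty K XM, symmetric])
    finally show "emeasure ?M1 X = emeasure ?M2 X" .
  next
    have "prob_space ?M1" by (rule prob_space_distr) measurable
    then show "emeasure ?M1 UNIV \<noteq> \<infinity>" by (simp add: prob_space.emeasure_eq_1_AE[of _ UNIV] prob_space_def finite_measure.emeasure_finite)
    show "range (\<lambda>_. UNIV) \<subseteq> {A \<times> B |A B. A \<in> sets borel \<and> B \<in> sets borel}"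
      by (auto intro!: exI[of _ UNIV])
  qed auto
  have "(\<integral>\<^sup>+\<omega>. h (W \<omega>, Z_of \<omega>) \<partial>p) = (\<integral>\<^sup>+x. h x \<partial>?M1)"
    by (subst nn_integral_distr) auto
  also have "\<dots> = (\<integral>\<^sup>+x. h x \<partial>?M2)" by (simp add: eqM)
  also have "\<dots> = (\<integral>\<^sup>+z. (\<integral>\<^sup>+x. h x \<partial>?K z) \<partial>N)"
    by (rule nn_integral_bind[OF h K])
  also have "\<dots> = (\<integral>\<^sup>+z. (\<integral>\<^sup>+w. h (w, z) \<partial>\<kappa> z) \<partial>N)"
    by (intro nn_integral_cong nn_integral_distr[OF pm]) measurable
  finally show ?thesis unfolding N_def .
qed

subsection \<open>A periodic bump\<close>

text \<open>For k <= r, the k-th derivative of sin(2 pi t)^r is (2 pi)^k sin(2 pi t)^(r-k) q_k(cos(2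
  pi t)); these are the polynomials q_k, and \<open>sin_wave r k\<close> is that derivative. The
  recursion comes from the product rule and sin^2 = 1 - cos^2. Keeping the power of the sine
  explicit makes the vanishing at integers visible.\<close>

primrec sin_deriv_poly :: "nat \<Rightarrow> nat \<Rightarrow> real poly" where
  "sin_deriv_poly r 0 = 1"
| "sin_deriv_poly r (Suc k) = smult (real (r - k)) ([:0, 1:] * sin_deriv_poly r k)
     - [:1, 0, -1:] * pderiv (sin_deriv_poly r k)"

definition sin_wave :: "nat \<Rightarrow> nat \<Rightarrow> real \<Rightarrow> real" where
  "sin_wave r k t = (2 * pi) ^ k * sin (2 * pi * t) ^ (r - k) * poly (sin_deriv_poly r k) (cos (2 * pi * t))"

lemma has_real_derivative_sin_wave:
  assumes "k < r"
  shows "(sin_wave r k has_real_derivative sin_wave r (Suc k) t) (at t)"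
proof -
  obtain j where j: "r - k = Suc j" using assms by (metis Suc_diff_Suc)
  then have j': "r - Suc k = j" by simp
  let ?q = "sin_deriv_poly r k"
  let ?s = "sin (2 * pi * t)" and ?c = "cos (2 * pi * t)"
  have "(sin_wave r k has_real_derivative
      (2 * pi) ^ k * (real (Suc j) * ?s ^ j * (?c * (2 * pi)) * poly ?q ?c
        + ?s ^ Suc j * (poly (pderiv ?q) ?c * (- ?s * (2 * pi))))) (at t)"
  proof -
    have s: "((\<lambda>t. sin (2 * pi * t)) has_real_derivative ?c * (2 * pi)) (at t)"
      and c: "((\<lambda>t. cos (2 * pi * t)) has_real_derivative - ?s * (2 * pi)) (at t)"
      by (auto intro!: derivative_eq_intros)
    have eq: "sin_wave r k = (\<lambda>t. (2 * pi) ^ k * (sin (2 * pi * t) ^ Suc j * poly ?q (cos (2 * pi * t))))"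
      by (simp add: fun_eq_iff sin_wave_def j)
    show ?thesis
      unfolding eq by (rule DERIV_cong[OF DERIV_cmult[OF DERIV_mult[OF DERIV_power[OF s] DERIV_chain2[OF poly_DERIV c]]]])
        (simp add: algebra_simps)
  qed
  also have "(2 * pi) ^ k * (real (Suc j) * ?s ^ j * (?c * (2 * pi)) * poly ?q ?c
        + ?s ^ Suc j * (poly (pderiv ?q) ?c * (- ?s * (2 * pi))))
      = (2 * pi) ^ Suc k * ?s ^ j * (real (Suc j) * (?c * poly ?q ?c) - ?s\<^sup>2 * poly (pderiv ?q) ?c)"
    by (simp add: algebra_simps power2_eq_square)
  also have "?s\<^sup>2 = 1 - ?c\<^sup>2" by (simp add: sin_squared_eq)
  also have "(2 * pi) ^ Suc k * ?s ^ j * (real (Suc j) * (?c * poly ?q ?c) - (1 - ?c\<^sup>2) * poly (pderiv ?q) ?c)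
      = sin_wave r (Suc k) t"
    by (simp add: sin_wave_def j j' power2_eq_square algebra_simps)
  finally show ?thesis .
qed

lemma sin_wave_bounded: "\<exists>C. \<forall>t. \<bar>sin_wave r k t\<bar> \<le> C"
proof -
  have "compact ((\<lambda>u. poly (sin_deriv_poly r k) u) ` {-1..1})"
    by (intro compact_continuous_image continuous_intros) auto
  then obtain M where M: "\<And>u. u \<in> {-1..1} \<Longrightarrow> \<bar>poly (sin_deriv_poly r k) u\<bar> \<le> M"
    using compact_imp_bounded bounded_iff by (metis imageI real_norm_def)
  have "\<bar>sin_wave r k t\<bar> \<le> (2 * pi) ^ k * 1 * M" for t
    unfolding sin_wave_def abs_mult
    by (intro mult_mono M) (auto simp: power_abs intro!: power_le_one)
  then show ?thesis by blast
qed

lemma sin_wave_periodic: "sin_wave r k (t + of_int i) = sin_wave r k t"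
proof -
  have "sin (2 * pi * (t + of_int i)) = sin (2 * pi * t)" "cos (2 * pi * (t + of_int i)) = cos (2 * pi * t)"
    by (simp_all add: distrib_left sin_add cos_add sin_integer_2pi cos_integer_2pi)
  then show ?thesis by (simp add: sin_wave_def)
qed

lemma sin_wave_int: "k < r \<Longrightarrow> sin_wave r k (of_int i) = 0"
  by (simp add: sin_wave_def sin_integer_2pi)

text \<open>\<open>b 0\<close> is a normalised first derivative of sin(2 pi t)^r. As the derivative
  of a periodic function it has mean zero over a period, and its derivatives up to order
  \<open>K\<close> still contain a positive power of the sine. The bound at order
  \<open>Suc K\<close> is what makes \<open>b K\<close> Lipschitz.\<close>

lemma bump_family:
  obtains b :: "nat \<Rightarrow> real \<Rightarrow> real" and C :: real where
    "\<And>k t. k \<le> K \<Longrightarrow> (b k has_real_derivative b (Suc k) t) (at t)"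
    "\<And>k t. k \<le> Suc K \<Longrightarrow> \<bar>b k t\<bar> \<le> C"
    "\<And>k i. k \<le> K \<Longrightarrow> b k (of_int i) = 0"
    "\<And>t i. b 0 (t + of_int i) = b 0 t"
    "\<And>t. \<bar>b 0 t\<bar> \<le> 1"
    "(\<integral>t. b 0 t * indicator {0..1} t \<partial>lborel) = 0"
    "0 < (\<integral>t. (b 0 t)\<^sup>2 * indicator {0..1} t \<partial>lborel)"
proof -
  define r where "r = K + 3"
  obtain c where c: "\<And>k t. \<bar>sin_wave r k t\<bar> \<le> c k" using sin_wave_bounded by metis
  \<comment> \<open>Dividing by the sum of all the bounds involved makes every derivative up to
    order \<open>Suc K\<close> at most 1; the added 1 keeps the divisor positive.\<close>
  define C0 where "C0 = (\<Sum>k\<le>K + 2. c k) + 1"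
  have c0: "0 \<le> c k" for k using c[of k 0] by linarith
  have C0: "0 < C0" unfolding C0_def using c0 by (simp add: sum_nonneg add_nonneg_pos)
  have cC: "c k \<le> C0" if "k \<le> K + 2" for k
  proof -
    have "c k \<le> (\<Sum>k\<le>K + 2. c k)" using that c0 by (intro member_le_sum) auto
    then show ?thesis by (simp add: C0_def)
  qed
  define b where "b k t = sin_wave r (Suc k) t / C0" for k t
  have der: "(b k has_real_derivative b (Suc k) t) (at t)" if "k \<le> K" for k t
    unfolding b_def using that by (intro DERIV_cdivide has_real_derivative_sin_wave) (simp add: r_def)
  have bd: "\<bar>b k t\<bar> \<le> 1" if "k \<le> Suc K" for k t
    using c[of "Suc k" t] cC[of "Suc k"] that C0 by (simp add: b_def)
  have cont: "isCont (b 0) t" for t using der[of 0 t] DERIV_isCont by blast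
  have "((\<lambda>t. sin_wave r 0 t / C0) has_real_derivative b 0 t) (at t)" for t
    unfolding b_def by (intro DERIV_cdivide has_real_derivative_sin_wave) (simp add: r_def)
  then have "(\<integral>t. b 0 t * indicator {0..1} t \<partial>lborel) = sin_wave r 0 1 / C0 - sin_wave r 0 0 / C0"
    using cont by (intro integral_FTC_Icc_real) auto
  also have "\<dots> = 0" using sin_wave_int[of 0 r 1] sin_wave_int[of 0 r 0] by (simp add: r_def)
  finally have mean: "(\<integral>t. b 0 t * indicator {0..1} t \<partial>lborel) = 0" .
  have contsq: "continuous_on {0..1} (\<lambda>t. (b 0 t)\<^sup>2)"
    using cont by (intro continuous_intros continuous_at_imp_continuous_on) auto
  then have int: "set_integrable lborel {0..1} (\<lambda>t. (b 0 t)\<^sup>2)"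
    by (intro borel_integrable_atLeastAtMost') auto
  have eq: "(\<integral>t. (b 0 t)\<^sup>2 * indicator {0..1} t \<partial>lborel) = (LINT t:{0..1}|lborel. (b 0 t)\<^sup>2)"
    by (simp add: set_lebesgue_integral_def mult.commute)
  have "(LINT t:{0..1}|lborel. (b 0 t)\<^sup>2) \<noteq> 0"
  proof
    assume "(LINT t:{0..1}|lborel. (b 0 t)\<^sup>2) = 0"
    then have "((\<lambda>t. (b 0 t)\<^sup>2) has_integral 0) (cbox 0 1)"
      using set_borel_integral_eq_integral[OF int] by (metis cbox_interval integrable_integral)
    \<comment> \<open>\<open>b 0\<close> is a nonzero multiple of sin^(r-1) times cos, both taken at
      2 pi t. At t = 1/8 neither factor vanishes.\<close>
    then have "(b 0 (1/8))\<^sup>2 = 0"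
      using contsq by (rule_tac has_integral_0_cbox_imp_0[of 0 1]) auto
    moreover have "sin (2 * pi * (1/8)) \<noteq> 0" "cos (2 * pi * (1/8)) \<noteq> 0"
      by (simp_all add: sin_45 cos_45)
    ultimately show False
      using C0 by (simp add: b_def sin_wave_def r_def pderiv_1)
  qed
  moreover have "0 \<le> (LINT t:{0..1}|lborel. (b 0 t)\<^sup>2)"
    unfolding set_lebesgue_integral_def by (intro integral_nonneg_AE) auto
  ultimately have "0 < (\<integral>t. (b 0 t)\<^sup>2 * indicator {0..1} t \<partial>lborel)" by (simp add: eq)
  moreover have "b k (of_int i) = 0" if "k \<le> K" for k i
    using that by (simp add: b_def sin_wave_int r_def)
  ultimately show ?thesis
    using der bd mean sin_wave_periodic[of r "Suc 0"]
    by (intro that[of b 1]) (auto simp: b_def)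
qed

section \<open>Uniform distribution on the unit interval and averages over its cells\<close>

definition unit_unif :: "real measure" where
  "unit_unif = density lborel (indicator {0..1})"

lemma sets_unit_unif [simp, measurable_cong]: "sets unit_unif = sets borel"
  and space_unit_unif [simp]: "space unit_unif = UNIV"
  by (simp_all add: unit_unif_def)

lemma prob_space_unit_unif: "prob_space unit_unif"
  by (rule prob_spaceI) (simp add: unit_unif_def emeasure_density)

interpretation U: prob_space unit_unif by (rule prob_space_unit_unif)

lemma integral_unit_unif:
  fixes f :: "real \<Rightarrow> real"
  assumes [measurable]: "f \<in> borel_measurable borel"
  shows "(\<integral>x. f x \<partial>unit_unif) = (\<integral>x. f x * indicator {0..1} x \<partial>lborel)"
proof -
  have "unit_unif = density lborel (\<lambda>x. ennreal (indicator {0..1} x))"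
    by (simp add: unit_unif_def ennreal_indicator)
  then show ?thesis using integral_density[of f lborel "indicator {0..1}"] by (simp add: mult.commute)
qed

lemma measurable_int_floor_mult [measurable]:
  "(\<lambda>x::real. e \<lfloor>c * x\<rfloor> :: real) \<in> borel_measurable borel"
  by (rule measurable_compose[of _ _ "count_space UNIV"]) auto

text \<open>An affine substitution carries each interval of length 1/m onto the unit interval, and
  by periodicity \<open>F\<close> looks the same on all of them; only the coefficient
  \<open>e\<close> tells the cells apart.\<close>

lemma integral_unit_unif_cells:
  fixes F :: "real \<Rightarrow> real" and e :: "int \<Rightarrow> real"
  assumes [measurable]: "F \<in> borel_measurable borel" and F: "\<And>t. \<bar>F t\<bar> \<le> M"
    and per: "\<And>t i. F (t + of_int i) = F t" and m: "0 < m"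
  shows "(\<integral>x. e \<lfloor>real m * x\<rfloor> * F (real m * x) \<partial>unit_unif)
    = (\<Sum>i\<in>{0..<int m}. e i) / m * (\<integral>x. F x \<partial>unit_unif)"
proof -
  let ?J = "\<lambda>i x. of_bool (\<lfloor>real m * x\<rfloor> = i) * F (real m * x)"
  \<comment> \<open>The point 1 has floor index 1, and m after scaling by m, just beyond the indices
    of the cells, although it belongs to the closed interval; it is discarded as a null set.\<close>
  have ne1: "AE x in lborel. x \<noteq> (1::real)" by (rule AE_lborel_singleton)
  have F0: "integrable lborel (\<lambda>x. of_bool (\<lfloor>x\<rfloor> = 0) * F x)"
  proof (rule Bochner_Integration.integrable_bound)
    show "integrable lborel (\<lambda>x. M * indicator {0..<1::real} x)" by simp
    show "AE x in lborel. norm (of_bool (\<lfloor>x\<rfloor> = 0) * F x) \<le> norm (M * indicator {0..<1::real} x)"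
      using F order_trans[OF F abs_ge_self] by (auto simp: indicator_def floor_eq_iff)
  qed auto
  have scale: "?J i (real_of_int i / m + 1 / m * u) = of_bool (\<lfloor>u\<rfloor> = 0) * F u" for i u
  proof -
    have "real m * (real_of_int i / m + 1 / m * u) = u + of_int i"
      using m by (simp add: field_simps)
    then show ?thesis by (simp add: per)
  qed
  have J: "integrable lborel (?J i)" for i
    using lborel_integrable_real_affine_iff[of "1 / real m" "?J i" "real_of_int i / m"] m F0
    by (simp add: scale[of i, simplified])
  have "(\<integral>x. ?J i x \<partial>lborel) = 1 / m * (\<integral>x. of_bool (\<lfloor>x\<rfloor> = 0) * F x \<partial>lborel)" for i
    using m by (subst lborel_integral_real_affine[of "1 / real m" _ "real_of_int i / m"]) (simp_all add: scale[of i, simplified])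
  moreover have "(\<integral>x. of_bool (\<lfloor>x\<rfloor> = 0) * F x \<partial>lborel) = (\<integral>x. F x \<partial>unit_unif)"
    using ne1 by (subst integral_unit_unif, simp, intro integral_cong_AE)
      (measurable, auto simp: floor_eq_iff indicator_def elim!: eventually_mono)
  ultimately have I: "(\<integral>x. ?J i x \<partial>lborel) = 1 / m * (\<integral>x. F x \<partial>unit_unif)" for i by simp
  have "(\<integral>x. e \<lfloor>real m * x\<rfloor> * F (real m * x) \<partial>unit_unif)
      = (\<integral>x. e \<lfloor>real m * x\<rfloor> * F (real m * x) * indicator {0..1} x \<partial>lborel)"
    by (subst integral_unit_unif) auto
  also have "\<dots> = (\<integral>x. (\<Sum>i\<in>{0..<int m}. e i * ?J i x) \<partial>lborel)"
  proof (rule integral_cong_AE)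
    show "AE x in lborel. e \<lfloor>real m * x\<rfloor> * F (real m * x) * indicator {0..1} x = (\<Sum>i\<in>{0..<int m}. e i * ?J i x)"
      using ne1
    proof eventually_elim
      case (elim x)
      have "(\<Sum>i\<in>{0..<int m}. e i * ?J i x) = (\<Sum>i\<in>{0..<int m}. if i = \<lfloor>real m * x\<rfloor> then e \<lfloor>real m * x\<rfloor> * F (real m * x) else 0)"
        by (intro sum.cong) auto
      also have "\<dots> = (if \<lfloor>real m * x\<rfloor> \<in> {0..<int m} then e \<lfloor>real m * x\<rfloor> * F (real m * x) else 0)"
        by (simp add: sum.delta)
      also have "\<lfloor>real m * x\<rfloor> \<in> {0..<int m} \<longleftrightarrow> x \<in> {0..1}"
        using m elim by (auto simp: floor_less_iff zero_le_mult_iff)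
      finally show ?case by (auto simp: indicator_def)
    qed
  qed measurable
  also have "\<dots> = (\<Sum>i\<in>{0..<int m}. e i * (1 / m * (\<integral>x. F x \<partial>unit_unif)))"
    using J by (subst Bochner_Integration.integral_sum) (auto simp: I)
  finally show ?thesis by (simp add: sum_distrib_right sum_divide_distrib)
qed

subsection \<open>Second moment method\<close>

lemma PiM_density:
  fixes f :: "'a \<Rightarrow> ennreal"
  assumes I: "finite I" and "sigma_finite_measure M" and "sigma_finite_measure (density M f)"
    and [measurable]: "f \<in> borel_measurable M"
  shows "(\<Pi>\<^sub>M i\<in>I. density M f) = density (\<Pi>\<^sub>M i\<in>I. M) (\<lambda>\<omega>. \<Prod>i\<in>I. f (\<omega> i))"
proof -
  interpret M: product_sigma_finite "\<lambda>i. M" by (rule product_sigma_finite.intro) fact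
  interpret D: product_sigma_finite "\<lambda>i. density M f" by (rule product_sigma_finite.intro) fact
  show ?thesis
  proof (rule D.PiM_eqI[OF I, symmetric])
    show "sets (density (\<Pi>\<^sub>M i\<in>I. M) (\<lambda>\<omega>. \<Prod>i\<in>I. f (\<omega> i))) = sets (\<Pi>\<^sub>M i\<in>I. density M f)"
      by (simp cong: sets_PiM_cong)
    fix A assume "\<And>i. i \<in> I \<Longrightarrow> A i \<in> sets (density M f)"
    then have A: "\<And>i. i \<in> I \<Longrightarrow> A i \<in> sets M" by simp
    have "emeasure (density (\<Pi>\<^sub>M i\<in>I. M) (\<lambda>\<omega>. \<Prod>i\<in>I. f (\<omega> i))) (Pi\<^sub>E I A)
        = (\<integral>\<^sup>+\<omega>. (\<Prod>i\<in>I. f (\<omega> i)) * indicator (Pi\<^sub>E I A) \<omega> \<partial>(\<Pi>\<^sub>M i\<in>I. M))"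
      using A I by (intro emeasure_density) (auto intro!: sets_PiM_I_finite)
    also have "\<dots> = (\<integral>\<^sup>+\<omega>. (\<Prod>i\<in>I. f (\<omega> i) * indicator (A i) (\<omega> i)) \<partial>(\<Pi>\<^sub>M i\<in>I. M))"
    proof (rule nn_integral_cong)
      fix \<omega> assume "\<omega> \<in> space (\<Pi>\<^sub>M i\<in>I. M)"
      then have "indicator (Pi\<^sub>E I A) \<omega> = (\<Prod>i\<in>I. indicator (A i) (\<omega> i) :: ennreal)"
        using I by (auto simp: indicator_def space_PiM PiE_def Pi_def)
      then show "(\<Prod>i\<in>I. f (\<omega> i)) * indicator (Pi\<^sub>E I A) \<omega> = (\<Prod>i\<in>I. f (\<omega> i) * indicator (A i) (\<omega> i))"
        by (simp add: prod.distrib)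
    qed
    also have "\<dots> = (\<Prod>i\<in>I. \<integral>\<^sup>+x. f x * indicator (A i) x \<partial>M)"
      using A I by (intro M.product_nn_integral_prod) auto
    also have "\<dots> = (\<Prod>i\<in>I. emeasure (density M f) (A i))"
      using A by (intro prod.cong) (auto simp: emeasure_density)
    finally show "emeasure (density (\<Pi>\<^sub>M i\<in>I. M) (\<lambda>\<omega>. \<Prod>i\<in>I. f (\<omega> i))) (Pi\<^sub>E I A)
        = (\<Prod>i\<in>I. emeasure (density M f) (A i))" .
  qed
qed

text \<open>Le Cam's method with a mixture. The assumption \<open>moment\<close> says that the
  uniform mixture over \<open>T\<close> of the n-fold laws has chi-square distance at most 1/4 from
  the n-fold product of \<open>U\<close>. The sum of the two errors, averaged over \<open>T\<close>,
  is then at least 1/2, so some single \<open>t\<close> attains this.\<close>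

lemma second_moment_lower_bound:
  fixes f :: "'i \<Rightarrow> 'a \<Rightarrow> real" and \<psi> :: "(nat \<Rightarrow> 'a) \<Rightarrow> real"
  assumes "prob_space U" and T: "finite T" "T \<noteq> {}"
    and f [measurable]: "\<And>t. f t \<in> borel_measurable U"
    and nonneg: "\<And>t x. 0 \<le> f t x" and bdd: "\<And>t x. f t x \<le> B"
    and int1: "\<And>t. (\<integral>x. f t x \<partial>U) = 1"
    and moment: "(\<Sum>s\<in>T. \<Sum>t\<in>T. (\<integral>x. f s x * f t x \<partial>U) ^ n) \<le> 5 / 4 * (real (card T))\<^sup>2"
    and \<psi> [measurable]: "\<psi> \<in> borel_measurable (\<Pi>\<^sub>M i\<in>{..<n}. U)"
    and \<psi>01: "\<And>\<omega>. \<omega> \<in> space (\<Pi>\<^sub>M i\<in>{..<n}. U) \<Longrightarrow> \<psi> \<omega> \<in> {0..1}"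
  shows "\<exists>t\<in>T. ennreal (1 / 2) \<le> (\<integral>\<^sup>+\<omega>. ennreal (\<psi> \<omega>) \<partial>(\<Pi>\<^sub>M i\<in>{..<n}. U))
    + (\<integral>\<^sup>+\<omega>. ennreal (1 - \<psi> \<omega>) \<partial>(\<Pi>\<^sub>M i\<in>{..<n}. density U (\<lambda>x. ennreal (f t x))))"
proof -
  interpret U: prob_space U by fact
  interpret P: product_prob_space "\<lambda>i::nat. U" "{..<n}" ..
  define M where "M = (\<Pi>\<^sub>M i\<in>{..<n}. U)"
  interpret M: prob_space M unfolding M_def by (rule prob_space_PiM) (rule assms(1))
  \<comment> \<open>Likelihood ratio of the n-fold product with density \<open>f t\<close> against
    the n-fold product of \<open>U\<close>.\<close>
  define G where "G t \<omega> = (\<Prod>i<n. f t (\<omega> i))" for t \<omega>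
  have Gm [measurable]: "G t \<in> borel_measurable M" for t unfolding G_def M_def by measurable
  have \<psi>m [measurable]: "\<psi> \<in> borel_measurable M" unfolding M_def by (rule \<psi>)
  have \<psi>01: "0 \<le> \<psi> \<omega>" "\<psi> \<omega> \<le> 1" if "\<omega> \<in> space M" for \<omega> using \<psi>01[of \<omega>] that by (auto simp: M_def)
  have G0: "0 \<le> G t \<omega>" for t \<omega> unfolding G_def by (intro prod_nonneg) (auto simp: nonneg)
  have "0 \<le> B" using order_trans[OF nonneg bdd] .
  have GB: "G t \<omega> \<le> B ^ n" for t \<omega>
    unfolding G_def using prod_mono[of "{..<n}" "\<lambda>i. f t (\<omega> i)" "\<lambda>_. B"] by (simp add: nonneg bdd)
  have f_int: "integrable U (f t)" for t
    using nonneg bdd by (intro U.integrable_const_bound[of _ B]) auto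
  have ff_int: "integrable U (\<lambda>x. f s x * f t x)" for s t
    using nonneg bdd \<open>0 \<le> B\<close>
    by (intro U.integrable_const_bound[of _ "B * B"]) (auto intro!: AE_I2 mult_mono simp: abs_mult)
  have G_int: "integrable M (G t)" for t
    using G0 GB by (intro M.integrable_const_bound[of _ "B ^ n"]) auto
  have GG_int: "integrable M (\<lambda>\<omega>. G s \<omega> * G t \<omega>)" for s t
    using G0 GB \<open>0 \<le> B\<close> by (intro M.integrable_const_bound[of _ "B ^ n * B ^ n"])
      (auto intro!: AE_I2 mult_mono simp: abs_mult)
  have \<psi>_int: "integrable M \<psi>"
    using \<psi>01 by (intro M.integrable_const_bound[of _ 1]) auto
  have \<psi>G_int: "integrable M (\<lambda>\<omega>. (1 - \<psi> \<omega>) * G t \<omega>)" for t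
  proof (intro M.integrable_const_bound[of _ "1 * B ^ n"] AE_I2)
    fix \<omega> assume "\<omega> \<in> space M"
    then have "\<bar>1 - \<psi> \<omega>\<bar> * \<bar>G t \<omega>\<bar> \<le> 1 * B ^ n"
      using \<psi>01[of \<omega>] G0[of t \<omega>] GB[of t \<omega>] by (intro mult_mono) auto
    then show "norm ((1 - \<psi> \<omega>) * G t \<omega>) \<le> 1 * B ^ n" by (simp add: abs_mult)
  qed measurable
  have EG: "(\<integral>\<omega>. G t \<omega> \<partial>M) = 1" for t
    unfolding G_def M_def by (subst P.product_integral_prod) (auto simp: f_int int1)
  have EGG: "(\<integral>\<omega>. G s \<omega> * G t \<omega> \<partial>M) = (\<integral>x. f s x * f t x \<partial>U) ^ n" for s t
    unfolding G_def M_def prod.distrib[symmetric]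
    by (subst P.product_integral_prod) (auto simp: ff_int)
  define c where "c = real (card T)"
  have c: "0 < c" using T by (simp add: c_def card_gt_0_iff)
  define S where "S \<omega> = (\<Sum>t\<in>T. G t \<omega>)" for \<omega>
  have SS: "(S \<omega>)\<^sup>2 = (\<Sum>s\<in>T. \<Sum>t\<in>T. G s \<omega> * G t \<omega>)" for \<omega>
    by (simp add: S_def power2_eq_square sum_product)
  have S_int: "integrable M S" unfolding S_def using G_int by simp
  have SS_int: "integrable M (\<lambda>\<omega>. (S \<omega>)\<^sup>2)" unfolding SS using GG_int by simp
  have ES: "(\<integral>\<omega>. S \<omega> \<partial>M) = c" unfolding S_def using G_int by (simp add: EG c_def)
  have ESS: "(\<integral>\<omega>. (S \<omega>)\<^sup>2 \<partial>M) \<le> 5 / 4 * c\<^sup>2"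
    unfolding SS c_def using moment GG_int by (simp add: EGG)
  \<comment> \<open>With d = S/c - 1 the integrand is c (3/4 - d^2). Since d^2 has expectation at
    most 5/4 - 1 = 1/4, this leaves c/2.\<close>
  have "c * (1 / 2) \<le> (\<integral>\<omega>. c * (3 / 4) - ((S \<omega>)\<^sup>2 / c - 2 * S \<omega> + c) \<partial>M)"
  proof -
    have "(\<integral>\<omega>. c * (3 / 4) - ((S \<omega>)\<^sup>2 / c - 2 * S \<omega> + c) \<partial>M)
        = c * (3 / 4) - ((\<integral>\<omega>. (S \<omega>)\<^sup>2 \<partial>M) / c - 2 * c + c)"
      using S_int SS_int by (simp add: ES M.prob_space)
    moreover have "(\<integral>\<omega>. (S \<omega>)\<^sup>2 \<partial>M) / c \<le> 5 / 4 * c"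
      using ESS c by (simp add: divide_simps power2_eq_square)
    ultimately show ?thesis by simp
  qed
  also have "\<dots> \<le> (\<integral>\<omega>. c * \<psi> \<omega> + (1 - \<psi> \<omega>) * S \<omega> \<partial>M)"
  proof (rule integral_mono_AE)
    show "integrable M (\<lambda>\<omega>. c * (3 / 4) - ((S \<omega>)\<^sup>2 / c - 2 * S \<omega> + c))" using S_int SS_int by simp
    show "integrable M (\<lambda>\<omega>. c * \<psi> \<omega> + (1 - \<psi> \<omega>) * S \<omega>)"
      unfolding S_def sum_distrib_left using \<psi>_int \<psi>G_int by simp
    show "AE \<omega> in M. c * (3 / 4) - ((S \<omega>)\<^sup>2 / c - 2 * S \<omega> + c) \<le> c * \<psi> \<omega> + (1 - \<psi> \<omega>) * S \<omega>"
    proof (rule AE_I2)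
      fix \<omega> assume "\<omega> \<in> space M"
      note \<psi>01 = \<psi>01[OF this]
      define d where "d = S \<omega> / c - 1"
      have Sd: "S \<omega> = c * (1 + d)" using c by (simp add: d_def)
      have "\<bar>(1 - \<psi> \<omega>) * d\<bar> \<le> 1 * \<bar>d\<bar>"
        unfolding abs_mult using \<psi>01 by (intro mult_right_mono) auto
      then have "- ((1 - \<psi> \<omega>) * d) \<le> \<bar>d\<bar>" by (metis abs_le_D2 mult_1)
      \<comment> \<open>Trading |d| for d^2 + 1/4 lets the second moment enter pointwise, in place
        of the Cauchy-Schwarz inequality.\<close>
      moreover have "0 \<le> (\<bar>d\<bar> - 1 / 2)\<^sup>2" by simp
      then have "\<bar>d\<bar> \<le> d\<^sup>2 + 1 / 4" by (simp add: power2_diff power_divide)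
      ultimately have "3 / 4 - d\<^sup>2 \<le> 1 + (1 - \<psi> \<omega>) * d" by linarith
      then have "c * (3 / 4 - d\<^sup>2) \<le> c * (1 + (1 - \<psi> \<omega>) * d)" using c by simp
      moreover have "(S \<omega>)\<^sup>2 / c = c * (1 + d)\<^sup>2" using c by (simp add: Sd power2_eq_square)
      ultimately show "c * (3 / 4) - ((S \<omega>)\<^sup>2 / c - 2 * S \<omega> + c) \<le> c * \<psi> \<omega> + (1 - \<psi> \<omega>) * S \<omega>"
        by (simp add: Sd power2_eq_square algebra_simps)
    qed
  qed
  also have "\<dots> = (\<Sum>t\<in>T. (\<integral>\<omega>. \<psi> \<omega> \<partial>M) + (\<integral>\<omega>. (1 - \<psi> \<omega>) * G t \<omega> \<partial>M))"
    unfolding S_def sum_distrib_left using \<psi>_int \<psi>G_int by (simp add: sum.distrib c_def)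
  finally have sum_le: "(\<Sum>t\<in>T. 1 / 2) \<le> (\<Sum>t\<in>T. (\<integral>\<omega>. \<psi> \<omega> \<partial>M) + (\<integral>\<omega>. (1 - \<psi> \<omega>) * G t \<omega> \<partial>M))"
    by (simp add: c_def)
  have "\<exists>t\<in>T. 1 / 2 \<le> (\<integral>\<omega>. \<psi> \<omega> \<partial>M) + (\<integral>\<omega>. (1 - \<psi> \<omega>) * G t \<omega> \<partial>M)"
  proof (rule ccontr)
    assume "\<not> (\<exists>t\<in>T. 1 / 2 \<le> (\<integral>\<omega>. \<psi> \<omega> \<partial>M) + (\<integral>\<omega>. (1 - \<psi> \<omega>) * G t \<omega> \<partial>M))"
    then have "(\<Sum>t\<in>T. (\<integral>\<omega>. \<psi> \<omega> \<partial>M) + (\<integral>\<omega>. (1 - \<psi> \<omega>) * G t \<omega> \<partial>M)) < (\<Sum>t\<in>T. 1 / 2)"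
      by (intro sum_strict_mono[OF T]) (auto simp: not_le)
    with sum_le show False by linarith
  qed
  then obtain t where t: "t \<in> T" "1 / 2 \<le> (\<integral>\<omega>. \<psi> \<omega> \<partial>M) + (\<integral>\<omega>. (1 - \<psi> \<omega>) * G t \<omega> \<partial>M)"
    by blast
  have e1: "(\<integral>\<^sup>+\<omega>. ennreal (\<psi> \<omega>) \<partial>M) = ennreal (\<integral>\<omega>. \<psi> \<omega> \<partial>M)"
    using \<psi>_int \<psi>01 by (intro nn_integral_eq_integral) auto
  have "sigma_finite_measure (density U (\<lambda>x. ennreal (f t x)))"
    by (subst U.sigma_finite_iff_density_finite) auto
  then have "(\<Pi>\<^sub>M i\<in>{..<n}. density U (\<lambda>x. ennreal (f t x))) = density M (\<lambda>\<omega>. ennreal (G t \<omega>))"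
    unfolding M_def G_def using U.sigma_finite_measure_axioms
    by (subst PiM_density) (auto simp: prod_ennreal nonneg)
  then have "(\<integral>\<^sup>+\<omega>. ennreal (1 - \<psi> \<omega>) \<partial>(\<Pi>\<^sub>M i\<in>{..<n}. density U (\<lambda>x. ennreal (f t x))))
      = (\<integral>\<^sup>+\<omega>. ennreal (G t \<omega>) * ennreal (1 - \<psi> \<omega>) \<partial>M)"
    by (simp add: nn_integral_density)
  also have "\<dots> = (\<integral>\<^sup>+\<omega>. ennreal ((1 - \<psi> \<omega>) * G t \<omega>) \<partial>M)"
    using G0 by (intro nn_integral_cong) (simp add: ennreal_mult' mult.commute)
  also have "\<dots> = ennreal (\<integral>\<omega>. (1 - \<psi> \<omega>) * G t \<omega> \<partial>M)"
    using \<psi>G_int \<psi>01 G0 by (intro nn_integral_eq_integral) auto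
  finally have e2: "(\<integral>\<^sup>+\<omega>. ennreal (1 - \<psi> \<omega>) \<partial>(\<Pi>\<^sub>M i\<in>{..<n}. density U (\<lambda>x. ennreal (f t x))))
      = ennreal (\<integral>\<omega>. (1 - \<psi> \<omega>) * G t \<omega> \<partial>M)" .
  have "0 \<le> (\<integral>\<omega>. \<psi> \<omega> \<partial>M)" "0 \<le> (\<integral>\<omega>. (1 - \<psi> \<omega>) * G t \<omega> \<partial>M)"
    using \<psi>01 G0 by (auto intro!: integral_nonneg_AE)
  then have "ennreal (\<integral>\<omega>. \<psi> \<omega> \<partial>M) + ennreal (\<integral>\<omega>. (1 - \<psi> \<omega>) * G t \<omega> \<partial>M)
      = ennreal ((\<integral>\<omega>. \<psi> \<omega> \<partial>M) + (\<integral>\<omega>. (1 - \<psi> \<omega>) * G t \<omega> \<partial>M))"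
    by (rule ennreal_plus[symmetric])
  with ennreal_leI[OF t(2)] show ?thesis
    using t(1) by (intro bexI[of _ t]) (simp_all only: e2 e1 flip: M_def)
qed

section \<open>Moment generating function of the overlap of two sign patterns\<close>

lemma cosh_le_exp_square: "cosh x \<le> exp (x\<^sup>2)" for x :: real
proof (cases "\<bar>x\<bar> \<le> 1")
  case True
  \<comment> \<open>Averaging this bound over y = x and y = -x cancels the linear term and leaves 1
    + x^2.\<close>
  have bd: "exp y \<le> 1 + y + y\<^sup>2" if "\<bar>y\<bar> \<le> 1" for y :: real
  proof (cases "0 \<le> y")
    case True
    then show ?thesis using exp_bound that by simp
  next
    case False
    have "exp y * (1 + (- y)) \<le> exp y * exp (- y)" by (intro mult_left_mono exp_ge_add_one_self) simp
    then have "exp y * (1 - y) \<le> 1" by (simp flip: exp_add)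
    \<comment> \<open>The product equals 1 - y^3, which is at least 1 for negative y.\<close>
    moreover have "1 \<le> (1 + y + y\<^sup>2) * (1 - y)"
      using False by (simp add: algebra_simps power2_eq_square mult_nonpos_nonneg zero_le_mult_iff mult_le_0_iff)
    ultimately have "exp y * (1 - y) \<le> (1 + y + y\<^sup>2) * (1 - y)" by linarith
    then show ?thesis using False by (subst (asm) mult_le_cancel_right) auto
  qed
  have "cosh x \<le> 1 + x\<^sup>2" using bd[of x] bd[of "- x"] True by (simp add: cosh_field_def)
  also have "\<dots> \<le> exp (x\<^sup>2)" by (rule exp_ge_add_one_self)
  finally show ?thesis .
next
  case False
  define E where "E = exp \<bar>x\<bar>"
  have "exp x + exp (- x) \<le> E + E" by (rule add_mono) (auto simp: E_def)
  then have "cosh x \<le> E" by (simp add: cosh_field_def)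
  then have "cosh x \<le> exp \<bar>x\<bar>" by (simp add: E_def)
  also have "\<bar>x\<bar> * 1 \<le> \<bar>x\<bar> * \<bar>x\<bar>" using False by (intro mult_left_mono) auto
  then have "exp \<bar>x\<bar> \<le> exp (x\<^sup>2)" by (simp add: power2_eq_square)
  finally show ?thesis .
qed

text \<open>Sign patterns are encoded by subsets, so that summing over all patterns is summing over
  a power set.\<close>

definition sign_of :: "'a set \<Rightarrow> 'a \<Rightarrow> real" where
  "sign_of A c = (if c \<in> A then 1 else - 1)"

text \<open>For fixed \<open>A\<close> the inner sum is 2^(card I) times the moment generating
  function of a sum of independent random signs, because multiplying them by the fixed signs of
  \<open>A\<close> does not change their law. It factorises into (2 cosh u)^(card I).\<close>

lemma sum_exp_sign_of_le:
  fixes I :: "'a set"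
  assumes I: "finite I"
  shows "(\<Sum>A\<in>Pow I. \<Sum>B\<in>Pow I. exp (u * (\<Sum>c\<in>I. sign_of A c * sign_of B c)))
    \<le> exp (u\<^sup>2 * real (card I)) * (real (card (Pow I)))\<^sup>2"
proof -
  have "(\<Sum>B\<in>Pow I. exp (u * (\<Sum>c\<in>I. sign_of A c * sign_of B c))) \<le> 2 ^ card I * exp (u\<^sup>2 * real (card I))" for A
  proof -
    have "exp (u * (\<Sum>c\<in>I. sign_of A c * sign_of B c))
        = (\<Prod>c\<in>B. exp (u * sign_of A c)) * (\<Prod>c\<in>I - B. exp (- u * sign_of A c))" if B: "B \<subseteq> I" for B
    proof -
      have "(\<Sum>c\<in>I. sign_of A c * sign_of B c) = (\<Sum>c\<in>I - B. sign_of A c * sign_of B c) + (\<Sum>c\<in>B. sign_of A c * sign_of B c)"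
        using sum.subset_diff[OF B I] .
      also have "\<dots> = (\<Sum>c\<in>I - B. - sign_of A c) + (\<Sum>c\<in>B. sign_of A c)"
        by (intro arg_cong2[where f="(+)"] sum.cong) (auto simp: sign_of_def)
      finally have eq: "(\<Sum>c\<in>I. sign_of A c * sign_of B c) = (\<Sum>c\<in>I - B. - sign_of A c) + (\<Sum>c\<in>B. sign_of A c)" .
      have "finite B" "finite (I - B)" using I finite_subset[OF B I] by auto
      then show ?thesis
        unfolding eq distrib_left sum_distrib_left exp_add
        by (simp only: exp_sum mult_minus_left mult_minus_right) (rule mult.commute)
    qed
    then have "(\<Sum>B\<in>Pow I. exp (u * (\<Sum>c\<in>I. sign_of A c * sign_of B c)))
        = (\<Sum>B\<in>Pow I. (\<Prod>c\<in>B. exp (u * sign_of A c)) * (\<Prod>c\<in>I - B. exp (- u * sign_of A c)))"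
      by (intro sum.cong) auto
    \<comment> \<open>Multiplying out the two-term factors gives exactly one summand for each subset
      \<open>B\<close>.\<close>
    also have "\<dots> = (\<Prod>c\<in>I. exp (u * sign_of A c) + exp (- u * sign_of A c))"
      using I by (rule prod_add[symmetric])
    also have "\<dots> = (\<Prod>c\<in>I. 2 * cosh u)"
      by (intro prod.cong) (auto simp: sign_of_def cosh_field_def)
    also have "\<dots> \<le> (\<Prod>c\<in>I. 2 * exp (u\<^sup>2))"
      by (intro prod_mono) (auto simp: cosh_le_exp_square)
    also have "\<dots> = 2 ^ card I * exp (u\<^sup>2 * real (card I))"
      by (simp add: power_mult_distrib exp_of_nat_mult mult.commute flip: exp_of_nat_mult)
    finally show ?thesis .
  qed
  then have "(\<Sum>A\<in>Pow I. \<Sum>B\<in>Pow I. exp (u * (\<Sum>c\<in>I. sign_of A c * sign_of B c)))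
      \<le> (\<Sum>A\<in>Pow I. 2 ^ card I * exp (u\<^sup>2 * real (card I)))"
    by (intro sum_mono)
  also have "\<dots> = exp (u\<^sup>2 * real (card I)) * (real (card (Pow I)))\<^sup>2"
    using I by (simp add: card_Pow power2_eq_square)
  finally show ?thesis .
qed

subsection \<open>Densities on the unit cube\<close>

definition unit_square_unif :: "(real \<times> real) measure" where
  "unit_square_unif = unit_unif \<Otimes>\<^sub>M unit_unif"

definition unit_cube_unif :: "triple measure" where
  "unit_cube_unif = unit_unif \<Otimes>\<^sub>M (unit_unif \<Otimes>\<^sub>M unit_unif)"

lemma sets_unit_square_unif [measurable_cong]: "sets unit_square_unif = sets (borel \<Otimes>\<^sub>M borel)"
  and sets_unit_cube_unif [measurable_cong]: "sets unit_cube_unif = sets (borel \<Otimes>\<^sub>M (borel \<Otimes>\<^sub>M borel))"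
  and space_unit_square_unif [simp]: "space unit_square_unif = UNIV"
  and space_unit_cube_unif [simp]: "space unit_cube_unif = UNIV"
  unfolding unit_square_unif_def unit_cube_unif_def
  by (simp_all add: space_pair_measure cong: sets_pair_measure_cong)

lemma sets_borel_triple: "sets (borel :: triple measure) = sets (borel \<Otimes>\<^sub>M (borel \<Otimes>\<^sub>M borel))"
  and sets_borel_pair: "sets (borel :: (real \<times> real) measure) = sets (borel \<Otimes>\<^sub>M borel)"
  unfolding borel_prod by (rule refl)+

lemma UNIV_sets_borel_prod [simp, measurable]:
  "(UNIV :: (real \<times> real) set) \<in> sets (borel \<Otimes>\<^sub>M borel)"
  "(UNIV :: triple set) \<in> sets (borel \<Otimes>\<^sub>M (borel \<Otimes>\<^sub>M borel))"
  by (metis sets_borel_pair sets.top space_borel, metis sets_borel_triple sets.top space_borel)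

lemma unit_square_cube_measurable:
  "{0..1::real} \<times> {0..1::real} \<in> sets borel"
  "{0..1::real} \<times> {0..1::real} \<times> {0..1::real} \<in> sets borel"
  by (intro borel_closed closed_Times closed_atLeastAtMost)+

interpretation UU: pair_prob_space unit_unif unit_unif ..

interpretation U2: prob_space unit_square_unif
  unfolding unit_square_unif_def by (rule UU.prob_space_axioms)

interpretation UUU: pair_prob_space unit_unif "unit_unif \<Otimes>\<^sub>M unit_unif" ..

interpretation U3: prob_space unit_cube_unif
  unfolding unit_cube_unif_def by (rule UUU.prob_space_axioms)

lemma unit_square_unif_eq_density:
  "unit_square_unif = density lborel (indicator ({0..1} \<times> {0..1}))"
proof -
  have s: "sigma_finite_measure (density lborel (indicator {0..1 :: real}))"
    using U.sigma_finite_measure_axioms by (simp add: unit_unif_def)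
  have "unit_square_unif = density (lborel \<Otimes>\<^sub>M lborel) (\<lambda>(x, y). indicator {0..1} x * indicator {0..1} y)"
    unfolding unit_square_unif_def unit_unif_def
    by (rule pair_measure_density) (auto simp: s lborel.sigma_finite_measure_axioms)
  also have "\<dots> = density lborel (indicator ({0..1} \<times> {0..1}))"
    unfolding lborel_prod by (rule arg_cong[where f="density lborel"]) (auto simp: indicator_def)
  finally show ?thesis .
qed

lemma unit_cube_unif_eq_density:
  "unit_cube_unif = density lborel (indicator ({0..1} \<times> {0..1} \<times> {0..1}))"
proof -
  have u2: "unit_unif \<Otimes>\<^sub>M unit_unif = density lborel (indicator ({0..1} \<times> {0..1}))"
    using unit_square_unif_eq_density by (simp add: unit_square_unif_def)
  have s: "sigma_finite_measure (density lborel (indicator ({0..1 :: real} \<times> {0..1 :: real})))"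
    using UU.sigma_finite_measure_axioms by (simp add: u2)
  have "unit_cube_unif = density (lborel \<Otimes>\<^sub>M lborel) (\<lambda>(x, w). indicator {0..1} x * indicator ({0..1} \<times> {0..1}) w)"
    unfolding unit_cube_unif_def u2 unfolding unit_unif_def
    by (rule pair_measure_density) (auto simp: s lborel.sigma_finite_measure_axioms intro!: borel_measurable_indicator unit_square_cube_measurable)
  also have "\<dots> = density lborel (indicator ({0..1} \<times> {0..1} \<times> {0..1}))"
    unfolding lborel_prod by (rule arg_cong[where f="density lborel"]) (auto simp: indicator_def)
  finally show ?thesis .
qed

lemma nn_integral_unit_square_unif:
  assumes h [measurable]: "h \<in> borel_measurable (borel \<Otimes>\<^sub>M borel)"
  shows "(\<integral>\<^sup>+w. h w \<partial>unit_square_unif) = (\<integral>\<^sup>+x. \<integral>\<^sup>+y. h (x, y) \<partial>unit_unif \<partial>unit_unif)"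
  unfolding unit_square_unif_def by (rule U.nn_integral_fst[symmetric]) measurable

text \<open>\<open>z\<close> is put outermost and \<open>y\<close> innermost so that facts about
  sections at fixed z, and about integrals in y alone, apply directly.\<close>

lemma nn_integral_unit_cube_unif:
  assumes h [measurable]: "h \<in> borel_measurable (borel \<Otimes>\<^sub>M (borel \<Otimes>\<^sub>M borel))"
  shows "(\<integral>\<^sup>+\<omega>. h \<omega> \<partial>unit_cube_unif)
    = (\<integral>\<^sup>+z. \<integral>\<^sup>+x. \<integral>\<^sup>+y. h (x, y, z) \<partial>unit_unif \<partial>unit_unif \<partial>unit_unif)"
proof -
  have "(\<integral>\<^sup>+\<omega>. h \<omega> \<partial>unit_cube_unif)
      = (\<integral>\<^sup>+x. \<integral>\<^sup>+w. h (x, w) \<partial>(unit_unif \<Otimes>\<^sub>M unit_unif) \<partial>unit_unif)"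
    unfolding unit_cube_unif_def by (rule UU.nn_integral_fst[symmetric]) measurable
  also have "\<dots> = (\<integral>\<^sup>+x. \<integral>\<^sup>+z. \<integral>\<^sup>+y. h (x, y, z) \<partial>unit_unif \<partial>unit_unif \<partial>unit_unif)"
    by (intro nn_integral_cong) (subst UU.nn_integral_snd[symmetric], auto)
  also have "\<dots> = (\<integral>\<^sup>+z. \<integral>\<^sup>+x. \<integral>\<^sup>+y. h (x, y, z) \<partial>unit_unif \<partial>unit_unif \<partial>unit_unif)"
    by (rule UU.Fubini') measurable
  finally show ?thesis .
qed

lemma Z_of_measurable: "Z_of \<in> borel \<Otimes>\<^sub>M (borel \<Otimes>\<^sub>M borel) \<rightarrow>\<^sub>M borel"
  and X_of_measurable: "X_of \<in> borel \<Otimes>\<^sub>M (borel \<Otimes>\<^sub>M borel) \<rightarrow>\<^sub>M borel"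
  and XY_of_measurable: "XY_of \<in> borel \<Otimes>\<^sub>M (borel \<Otimes>\<^sub>M borel) \<rightarrow>\<^sub>M borel \<Otimes>\<^sub>M borel"
  by measurable

text \<open>A density with respect to the uniform distribution on the cube all of whose sections
  at fixed \<open>z\<close> integrate to one, so that \<open>Z\<close> is uniform and no normalisation enters the conditional densities.\<close>

locale section_density =
  fixes f :: "triple \<Rightarrow> ennreal"
  assumes f [measurable]: "f \<in> borel_measurable (borel \<Otimes>\<^sub>M (borel \<Otimes>\<^sub>M borel))"
    and f_sections: "\<And>z. (\<integral>\<^sup>+x. \<integral>\<^sup>+y. f (x, y, z) \<partial>unit_unif \<partial>unit_unif) = 1"
begin

abbreviation law :: "triple measure" where
  "law \<equiv> density unit_cube_unif f"

definition kernel :: "real \<Rightarrow> (real \<times> real) measure" where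
  "kernel z = density unit_square_unif (\<lambda>w. f (fst w, snd w, z))"

lemma sets_law: "sets law = sets borel"
  by (simp add: sets_unit_cube_unif sets_borel_triple)

lemma prob_space_law: "prob_space law"
proof (rule prob_spaceI)
  have "emeasure law (space law) = (\<integral>\<^sup>+\<omega>. f \<omega> \<partial>unit_cube_unif)"
    by (subst emeasure_density) (auto simp: sets_unit_cube_unif)
  also have "\<dots> = 1"
    by (simp add: nn_integral_unit_cube_unif f_sections U.emeasure_space_1[simplified])
  finally show "emeasure law (space law) = 1" .
qed

lemma law_in_E0: "law \<in> E0"
proof -
  have m: "indicator ({0..1} \<times> {0..1} \<times> {0..1}) \<in> borel_measurable (lborel :: triple measure)"
    by (intro borel_measurable_indicator) (simp add: unit_square_cube_measurable)
  have fm: "f \<in> borel_measurable lborel"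
    by (simp add: measurable_cong_sets[OF sets_lborel refl] measurable_cong_sets[OF sets_borel_triple refl])
  have law: "law = density lborel (\<lambda>\<omega>. indicator ({0..1} \<times> {0..1} \<times> {0..1}) \<omega> * f \<omega>)"
    unfolding unit_cube_unif_eq_density using m fm by (intro density_density_eq)
  have c: "{0..1} \<times> {0..1} \<times> {0..1} \<in> sets (lborel :: triple measure)"
    by (simp add: unit_square_cube_measurable)
  have "emeasure law ({0..1} \<times> {0..1} \<times> {0..1}) = emeasure law (space law)"
    unfolding law using m fm c
    by (subst (1 2) emeasure_density) (auto intro!: nn_integral_cong simp: indicator_def)
  also have "\<dots> = 1" by (rule prob_space.emeasure_space_1[OF prob_space_law])
  finally have "emeasure law ({0..1} \<times> {0..1} \<times> {0..1}) = 1" .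
  moreover have "absolutely_continuous lborel law"
    unfolding law using m fm by (intro absolutely_continuousI_density borel_measurable_times_ennreal)
  ultimately show ?thesis
    using prob_space_law sets_law by (simp add: E0_def)
qed

lemma emeasure_kernel:
  assumes [measurable]: "A \<in> sets (borel \<Otimes>\<^sub>M borel)"
  shows "emeasure (kernel z) A = (\<integral>\<^sup>+x. \<integral>\<^sup>+y. f (x, y, z) * indicator A (x, y) \<partial>unit_unif \<partial>unit_unif)"
  unfolding kernel_def by (subst emeasure_density, measurable) (subst nn_integral_unit_square_unif, auto)

lemma prob_space_kernel: "prob_space (kernel z)"
  using emeasure_kernel[of UNIV z] f_sections[of z]
  by (intro prob_spaceI) (simp add: kernel_def)

lemma emeasure_law_rectangle:
  assumes [measurable]: "A \<in> sets (borel \<Otimes>\<^sub>M borel)" "B \<in> sets borel"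
  shows "emeasure law {\<omega> \<in> space law. XY_of \<omega> \<in> A \<and> Z_of \<omega> \<in> B}
    = (\<integral>\<^sup>+z\<in>B. emeasure (kernel z) A \<partial>unit_unif)"
proof -
  have [measurable]: "{\<omega>. XY_of \<omega> \<in> A \<and> Z_of \<omega> \<in> B} \<in> sets (borel \<Otimes>\<^sub>M (borel \<Otimes>\<^sub>M borel))"
    using measurable_sets[OF XY_of_measurable assms(1)] measurable_sets[OF Z_of_measurable assms(2)]
    by (auto simp: space_pair_measure vimage_def Collect_conj_eq)
  have "emeasure law {\<omega> \<in> space law. XY_of \<omega> \<in> A \<and> Z_of \<omega> \<in> B}
      = (\<integral>\<^sup>+\<omega>. f \<omega> * indicator {\<omega>. XY_of \<omega> \<in> A \<and> Z_of \<omega> \<in> B} \<omega> \<partial>unit_cube_unif)"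
    by (subst emeasure_density) auto
  also have "\<dots> = (\<integral>\<^sup>+z. \<integral>\<^sup>+x. \<integral>\<^sup>+y. f (x, y, z) * indicator {\<omega>. XY_of \<omega> \<in> A \<and> Z_of \<omega> \<in> B} (x, y, z) \<partial>unit_unif \<partial>unit_unif \<partial>unit_unif)"
    by (rule nn_integral_unit_cube_unif) measurable
  also have "\<dots> = (\<integral>\<^sup>+z\<in>B. emeasure (kernel z) A \<partial>unit_unif)"
    by (intro nn_integral_cong) (simp add: emeasure_kernel indicator_def)
  finally show ?thesis .
qed

lemma distr_law_Z: "distr law borel Z_of = unit_unif"
proof (rule measure_eqI)
  fix B assume "B \<in> sets (distr law borel Z_of)"
  then have [measurable]: "B \<in> sets borel" by simp
  have "emeasure (distr law borel Z_of) B = emeasure law (Z_of -` B \<inter> space law)"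
    by (rule emeasure_distr) measurable
  also have "Z_of -` B \<inter> space law = {\<omega> \<in> space law. XY_of \<omega> \<in> UNIV \<and> Z_of \<omega> \<in> B}" by auto
  also have "emeasure law \<dots> = (\<integral>\<^sup>+z\<in>B. emeasure (kernel z) UNIV \<partial>unit_unif)"
    by (rule emeasure_law_rectangle) auto
  also have "\<dots> = (\<integral>\<^sup>+z\<in>B. 1 \<partial>unit_unif)"
    by (subst emeasure_kernel) (auto simp: f_sections)
  finally show "emeasure (distr law borel Z_of) B = emeasure unit_unif B" by simp
qed simp

lemma cond_distr_XY: "cond_distr law XY_of kernel"
  unfolding cond_distr_def
proof (intro conjI ballI)
  show "kernel \<in> borel \<rightarrow>\<^sub>M prob_algebra borel"
  proof (intro measurable_prob_algebraI prob_space_kernel measurable_subprob_algebra)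
    fix z
    show "subprob_space (kernel z)" by (rule prob_space_imp_subprob_space[OF prob_space_kernel])
    show "sets (kernel z) = sets borel"
      by (simp add: kernel_def sets_unit_square_unif sets_borel_pair)
  next
    fix A :: "(real \<times> real) set" assume "A \<in> sets borel"
    then have [measurable]: "A \<in> sets (borel \<Otimes>\<^sub>M borel)" by (simp add: sets_borel_pair)
    show "(\<lambda>z. emeasure (kernel z) A) \<in> borel_measurable borel"
      by (subst emeasure_kernel) measurable
  qed
next
  fix A :: "(real \<times> real) set" and B :: "real set" assume "A \<in> sets borel" "B \<in> sets borel"
  then show "emeasure law {\<omega> \<in> space law. XY_of \<omega> \<in> A \<and> Z_of \<omega> \<in> B}
      = (\<integral>\<^sup>+z\<in>B. emeasure (kernel z) A \<partial>distr law borel Z_of)"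
    by (simp only: distr_law_Z emeasure_law_rectangle sets_borel_pair)
qed

end

section \<open>The uniform law as a member of both null classes\<close>

lemma section_density_one: "section_density (\<lambda>_. 1)"
  by standard (simp_all add: U.emeasure_space_1[simplified])

interpretation one: section_density "\<lambda>_. 1" by (rule section_density_one)

lemma cond_distr_uniform_marginals:
  assumes xy: "cond_distr p XY_of (\<lambda>_. unit_unif \<Otimes>\<^sub>M unit_unif)"
  shows "cond_distr p X_of (\<lambda>_. unit_unif)" "cond_distr p Y_of (\<lambda>_. unit_unif)"
proof -
  have u: "(\<lambda>_. unit_unif) \<in> borel \<rightarrow>\<^sub>M prob_algebra borel"
    by (intro measurable_const) (simp add: space_prob_algebra prob_space_unit_unif)
  note eq = xy[unfolded cond_distr_def, THEN conjunct2, rule_format]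
  show "cond_distr p X_of (\<lambda>_. unit_unif)"
    unfolding cond_distr_def
  proof (intro conjI ballI u)
    fix A B :: "real set" assume AB: "A \<in> sets borel" "B \<in> sets borel"
    then have "A \<times> UNIV \<in> sets (borel :: (real \<times> real) measure)" by (simp add: borel_Times)
    from eq[OF this AB(2)] AB show "emeasure p {\<omega> \<in> space p. X_of \<omega> \<in> A \<and> Z_of \<omega> \<in> B}
        = (\<integral>\<^sup>+z\<in>B. emeasure unit_unif A \<partial>distr p borel Z_of)"
      by (simp add: U.emeasure_pair_measure_Times U.emeasure_space_1[simplified] split_beta')
  qed
  show "cond_distr p Y_of (\<lambda>_. unit_unif)"
    unfolding cond_distr_def
  proof (intro conjI ballI u)
    fix A B :: "real set" assume AB: "A \<in> sets borel" "B \<in> sets borel"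
    then have "UNIV \<times> A \<in> sets (borel :: (real \<times> real) measure)" by (simp add: borel_Times)
    from eq[OF this AB(2)] AB show "emeasure p {\<omega> \<in> space p. Y_of \<omega> \<in> A \<and> Z_of \<omega> \<in> B}
        = (\<integral>\<^sup>+z\<in>B. emeasure unit_unif A \<partial>distr p borel Z_of)"
      by (simp add: U.emeasure_pair_measure_Times U.emeasure_space_1[simplified] split_beta')
  qed
qed

lemma cond_distr_unit_cube_unif:
  "cond_distr unit_cube_unif XY_of (\<lambda>_. unit_unif \<Otimes>\<^sub>M unit_unif)"
  using one.cond_distr_XY by (simp add: one.kernel_def[abs_def] density_1 unit_square_unif_def)

text \<open>The conditional laws of X and of Y have versions that do not depend on z, so both the L1
  and the chi-square distance between them vanish, for every \<open>L\<close>.\<close>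

lemma
  shows unit_cube_unif_in_P0_TV: "unit_cube_unif \<in> P0_TV L"
    and unit_cube_unif_in_P0_chi2: "unit_cube_unif \<in> P0_chi2 L"
proof -
  have "unit_cube_unif \<in> E0" using one.law_in_E0 by (simp add: density_1)
  then have P0: "unit_cube_unif \<in> P0"
    unfolding P0_def cond_indep_XY_given_Z_def
    using cond_distr_unit_cube_unif cond_distr_uniform_marginals[OF cond_distr_unit_cube_unif] by blast
  show "unit_cube_unif \<in> P0_TV L"
    unfolding P0_TV_def using P0 cond_distr_uniform_marginals[OF cond_distr_unit_cube_unif]
    by (intro CollectI conjI exI[of _ "\<lambda>_. unit_unif"]) auto
  show "unit_cube_unif \<in> P0_chi2 L"
    unfolding P0_chi2_def using P0 cond_distr_uniform_marginals[OF cond_distr_unit_cube_unif]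
    by (intro CollectI conjI exI[of _ "\<lambda>_. unit_unif"]) (auto simp: chi2_div_self[OF U.finite_measure_axioms])
qed

subsection \<open>Separation from conditional independence\<close>

text \<open>Averaging \<open>h\<close> over the kernel of \<open>Y\<close> under \<open>q\<close> turns the expectation of \<open>h\<close> into that of a
  function of \<open>(X, Z)\<close> alone, whose expectation under the law with density \<open>f\<close> is one.\<close>

lemma nn_integral_le_l1_dist_P0:
  fixes f h :: "triple \<Rightarrow> ennreal"
  assumes f [measurable]: "f \<in> borel_measurable (borel \<Otimes>\<^sub>M (borel \<Otimes>\<^sub>M borel))"
    and h [measurable]: "h \<in> borel_measurable (borel \<Otimes>\<^sub>M (borel \<Otimes>\<^sub>M borel))"
    and fy: "\<And>x z. (\<integral>\<^sup>+y. f (x, y, z) \<partial>unit_unif) = 1"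
    and hx: "\<And>y z. (\<integral>\<^sup>+x. h (x, y, z) \<partial>unit_unif) = 1"
    and h2: "\<And>\<omega>. h \<omega> \<le> 2" and q: "q \<in> P0"
  shows "(\<integral>\<^sup>+\<omega>. h \<omega> \<partial>density unit_cube_unif f) \<le> 1 + 4 * l1_dist (density unit_cube_unif f) q"
proof -
  interpret section_density f
    by standard (auto simp: fy U.emeasure_space_1[simplified])
  have "prob_space q" and sq: "sets q = sets borel"
    using q by (auto simp: P0_def E0_def)
  interpret p: prob_space law by (rule prob_space_law)
  interpret q: prob_space q by fact
  have sq' [measurable_cong]: "sets q = sets (borel \<Otimes>\<^sub>M (borel \<Otimes>\<^sub>M borel))"
    using sq by (simp add: sets_borel_triple)
  obtain \<kappa>X \<kappa>Y where \<kappa>X: "cond_distr q X_of \<kappa>X" and \<kappa>Y: "cond_distr q Y_of \<kappa>Y"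
    and \<kappa>XY: "cond_distr q XY_of (\<lambda>z. \<kappa>X z \<Otimes>\<^sub>M \<kappa>Y z)"
    using q by (auto simp: P0_def cond_indep_XY_given_Z_def)
  have kX: "\<kappa>X \<in> borel \<rightarrow>\<^sub>M prob_algebra borel" and kY: "\<kappa>Y \<in> borel \<rightarrow>\<^sub>M prob_algebra borel"
    using \<kappa>X \<kappa>Y by (auto simp: cond_distr_def)
  note kY' [measurable] = measurable_prob_algebraD[OF kY]
  have sX [measurable_cong]: "sets (\<kappa>X z) = sets borel" and sY [measurable_cong]: "sets (\<kappa>Y z) = sets borel"
    and pX: "prob_space (\<kappa>X z)" and pY: "prob_space (\<kappa>Y z)" for z
    using measurable_space[OF kX, of z] measurable_space[OF kY, of z] by (auto simp: space_prob_algebra)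
  define H where "H w = (\<integral>\<^sup>+y. h (fst w, y, snd w) \<partial>\<kappa>Y (snd w))" for w
  have H [measurable]: "H \<in> borel_measurable (borel \<Otimes>\<^sub>M borel)"
    unfolding H_def by (rule nn_integral_measurable_subprob_algebra2[where N=borel]) measurable
  have H2: "H w \<le> 2" for w
  proof -
    interpret prob_space "\<kappa>Y (snd w)" by (rule pY)
    have "H w \<le> (\<integral>\<^sup>+y. 2 \<partial>\<kappa>Y (snd w))" unfolding H_def by (intro nn_integral_mono h2)
    then show ?thesis by (simp add: emeasure_space_1)
  qed
  note cm = measurable_cong_sets[OF sq' refl] measurable_cong_sets[OF sets_borel_pair refl]
    measurable_cong_sets[OF refl sets_borel_pair]
  \<comment> \<open>(X, Y) is disintegrated along Z, y is integrated out of the product kernel, and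
    the disintegration is then undone for X alone.\<close>
  have "(\<integral>\<^sup>+\<omega>. h \<omega> \<partial>q) = (\<integral>\<^sup>+\<omega>. h (fst (XY_of \<omega>), snd (XY_of \<omega>), Z_of \<omega>) \<partial>q)"
    by (intro nn_integral_cong) auto
  also have "\<dots> = (\<integral>\<^sup>+z. (\<integral>\<^sup>+w. h (fst w, snd w, z) \<partial>(\<kappa>X z \<Otimes>\<^sub>M \<kappa>Y z)) \<partial>distr q borel Z_of)"
  proof -
    have 1: "XY_of \<in> q \<rightarrow>\<^sub>M borel" unfolding cm by (rule XY_of_measurable)
    have "(\<lambda>v. h (fst (fst v), snd (fst v), snd v)) \<in> borel_measurable ((borel \<Otimes>\<^sub>M borel) \<Otimes>\<^sub>M borel)"
      by measurable
    then have "(\<lambda>v. h (fst (fst v), snd (fst v), snd v)) \<in> borel_measurable (borel \<Otimes>\<^sub>M borel)"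
      by (simp add: borel_prod)
    from nn_integral_cond_distr[OF \<open>prob_space q\<close> sq 1 \<kappa>XY this] show ?thesis by simp
  qed
  also have "\<dots> = (\<integral>\<^sup>+z. (\<integral>\<^sup>+x. H (x, z) \<partial>\<kappa>X z) \<partial>distr q borel Z_of)"
  proof (rule nn_integral_cong)
    fix z
    interpret Y: prob_space "\<kappa>Y z" by (rule pY)
    show "(\<integral>\<^sup>+w. h (fst w, snd w, z) \<partial>(\<kappa>X z \<Otimes>\<^sub>M \<kappa>Y z)) = (\<integral>\<^sup>+x. H (x, z) \<partial>\<kappa>X z)"
      by (subst Y.nn_integral_fst[symmetric]) (auto simp: H_def)
  qed
  also have "\<dots> = (\<integral>\<^sup>+\<omega>. H (X_of \<omega>, Z_of \<omega>) \<partial>q)"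
  proof -
    have "X_of \<in> q \<rightarrow>\<^sub>M borel" unfolding cm by (rule X_of_measurable)
    from nn_integral_cond_distr[OF \<open>prob_space q\<close> sq this \<kappa>X H] show ?thesis by simp
  qed
  finally have hq: "(\<integral>\<^sup>+\<omega>. h \<omega> \<partial>q) = (\<integral>\<^sup>+\<omega>. H (X_of \<omega>, Z_of \<omega>) \<partial>q)" .
  have HXZ: "(\<lambda>\<omega>. H (X_of \<omega>, Z_of \<omega>)) \<in> borel_measurable (borel \<Otimes>\<^sub>M (borel \<Otimes>\<^sub>M borel))"
    by measurable
  \<comment> \<open>\<open>H\<close> does not involve y, so \<open>fy\<close> removes
    \<open>f\<close>. Then x is uniform and can be integrated before the average over y, where
    \<open>hx\<close> applies.\<close>
  have "(\<integral>\<^sup>+\<omega>. H (X_of \<omega>, Z_of \<omega>) \<partial>law) = (\<integral>\<^sup>+\<omega>. f \<omega> * H (X_of \<omega>, Z_of \<omega>) \<partial>unit_cube_unif)"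
    using HXZ by (subst nn_integral_density) measurable
  also have "\<dots> = (\<integral>\<^sup>+z. \<integral>\<^sup>+x. \<integral>\<^sup>+y. f (x, y, z) * H (x, z) \<partial>unit_unif \<partial>unit_unif \<partial>unit_unif)"
    using HXZ by (subst nn_integral_unit_cube_unif) auto
  also have "\<dots> = (\<integral>\<^sup>+z. \<integral>\<^sup>+x. H (x, z) \<partial>unit_unif \<partial>unit_unif)"
    by (intro nn_integral_cong) (simp add: nn_integral_multc fy)
  also have "\<dots> = (\<integral>\<^sup>+z. \<integral>\<^sup>+y. \<integral>\<^sup>+x. h (x, y, z) \<partial>unit_unif \<partial>\<kappa>Y z \<partial>unit_unif)"
  proof (rule nn_integral_cong)
    fix z
    interpret Y: prob_space "\<kappa>Y z" by (rule pY)
    interpret pair_sigma_finite unit_unif "\<kappa>Y z" ..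
    show "(\<integral>\<^sup>+x. H (x, z) \<partial>unit_unif) = (\<integral>\<^sup>+y. \<integral>\<^sup>+x. h (x, y, z) \<partial>unit_unif \<partial>\<kappa>Y z)"
      unfolding H_def by (simp, rule Fubini'[symmetric]) measurable
  qed
  also have "\<dots> = 1"
    by (simp add: hx prob_space.emeasure_space_1[OF pY] U.emeasure_space_1[simplified])
  finally have Hp: "(\<integral>\<^sup>+\<omega>. H (X_of \<omega>, Z_of \<omega>) \<partial>law) = 1" .
  \<comment> \<open>One passage from \<open>law\<close> to \<open>q\<close> for \<open>h\<close> and
    one back for \<open>H\<close>, each at a price of 2 times the distance: hence the factor
    4.\<close>
  note l1 = nn_integral_le_l1_dist[OF p.finite_measure_axioms q.finite_measure_axioms]
  have "(\<integral>\<^sup>+\<omega>. h \<omega> \<partial>law) \<le> (\<integral>\<^sup>+\<omega>. h \<omega> \<partial>q) + 2 * l1_dist law q"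
    by (rule l1) (simp_all add: sets_unit_cube_unif sq' h2)
  also have "(\<integral>\<^sup>+\<omega>. h \<omega> \<partial>q) \<le> (\<integral>\<^sup>+\<omega>. H (X_of \<omega>, Z_of \<omega>) \<partial>law) + 2 * l1_dist law q"
    unfolding hq using HXZ by (intro l1) (simp_all add: sets_unit_cube_unif sq' H2)
  also have "\<dots> + 2 * l1_dist law q = 1 + 4 * l1_dist law q"
    by (simp add: Hp add.assoc flip: distrib_right)
  finally show ?thesis by (simp add: add_right_mono)
qed

section \<open>Waves with a free coefficient on each box\<close>

definition wave :: "(real \<Rightarrow> real) \<Rightarrow> nat \<Rightarrow> nat \<Rightarrow> (int \<times> int \<times> int \<Rightarrow> real) \<Rightarrow> triple \<Rightarrow> real" where
  "wave g m k e = (\<lambda>(x, y, z). e (\<lfloor>real m * x\<rfloor>, \<lfloor>real m * y\<rfloor>, \<lfloor>real k * z\<rfloor>)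
     * (g (real m * x) * g (real m * y) * g (real k * z)))"

definition cells :: "nat \<Rightarrow> nat \<Rightarrow> (int \<times> int \<times> int) set" where
  "cells m k = {0..<int m} \<times> {0..<int m} \<times> {0..<int k}"

lemma finite_cells [simp]: "finite (cells m k)"
  and card_cells: "card (cells m k) = m * m * k"
  by (simp_all add: cells_def)

lemma wave_measurable [measurable]:
  assumes [measurable]: "g \<in> borel_measurable borel"
  shows "wave g m k e \<in> borel_measurable (borel \<Otimes>\<^sub>M (borel \<Otimes>\<^sub>M borel))"
proof -
  have e [measurable]: "e \<in> borel_measurable (count_space UNIV \<Otimes>\<^sub>M (count_space UNIV \<Otimes>\<^sub>M count_space UNIV))"
    by (simp add: pair_measure_countable)
  show ?thesis unfolding wave_def split_beta' by measurable
qed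

lemma wave_bounded:
  assumes "\<And>t. \<bar>g t\<bar> \<le> 1" "\<And>c. \<bar>e c\<bar> \<le> 1"
  shows "\<bar>wave g m k e \<omega>\<bar> \<le> 1"
proof -
  obtain x y z where \<omega>: "\<omega> = (x, y, z)" by (cases \<omega>)
  have "\<bar>wave g m k e \<omega>\<bar> \<le> 1 * (1 * 1 * 1)"
    unfolding wave_def \<omega> prod.case abs_mult using assms by (intro mult_mono) auto
  then show ?thesis by simp
qed

text \<open>Profile and coefficients are kept general because, by \<open>wave_mult\<close>, a
  product of two waves is again a wave, with the profile squared and the coefficients multiplied.
  The same formula thus yields both the mean of a perturbation and the overlap of two of
  them.\<close>

lemma integral_wave:
  assumes [measurable]: "g \<in> borel_measurable borel" and g: "\<And>t. \<bar>g t\<bar> \<le> 1"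
    and per: "\<And>t i. g (t + of_int i) = g t" and e: "\<And>c. \<bar>e c\<bar> \<le> 1" and m: "0 < m" and k: "0 < k"
  shows "(\<integral>\<omega>. wave g m k e \<omega> \<partial>unit_cube_unif)
    = (\<Sum>c\<in>cells m k. e c) / (real m * real m * real k) * (\<integral>t. g t \<partial>unit_unif) ^ 3"
proof -
  let ?G = "\<integral>t. g t \<partial>unit_unif"
  note cell = integral_unit_unif_cells[OF assms(1) g per]
  have wm: "wave g m k e \<in> borel_measurable (unit_unif \<Otimes>\<^sub>M (unit_unif \<Otimes>\<^sub>M unit_unif))"
    using wave_measurable[OF assms(1)] by (simp cong: measurable_cong_sets sets_pair_measure_cong)
  have int: "integrable (unit_unif \<Otimes>\<^sub>M (unit_unif \<Otimes>\<^sub>M unit_unif)) (wave g m k e)"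
    using wm wave_bounded[of g e] g e by (intro UUU.integrable_const_bound[of _ 1]) auto
  have int2: "integrable (unit_unif \<Otimes>\<^sub>M unit_unif) (\<lambda>w. wave g m k e (x, w))" for x
    using measurable_compose[OF measurable_Pair1' wm] wave_bounded[of g e] g e
    by (intro UU.integrable_const_bound[of _ 1]) auto
  have "(\<integral>\<omega>. wave g m k e \<omega> \<partial>unit_cube_unif)
      = (\<integral>x. \<integral>y. \<integral>z. wave g m k e (x, y, z) \<partial>unit_unif \<partial>unit_unif \<partial>unit_unif)"
    unfolding unit_cube_unif_def
    by (simp add: UUU.integral_fst'[OF int, symmetric] UU.integral_fst'[OF int2, symmetric])
  also have "\<dots> = (\<integral>x. \<integral>y. (\<Sum>l\<in>{0..<int k}. e (\<lfloor>real m * x\<rfloor>, \<lfloor>real m * y\<rfloor>, l)) / k * ?G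
      * (g (real m * x) * g (real m * y)) \<partial>unit_unif \<partial>unit_unif)"
  proof -
    have "(\<integral>z. wave g m k e (x, y, z) \<partial>unit_unif) = (\<Sum>l\<in>{0..<int k}. e (\<lfloor>real m * x\<rfloor>, \<lfloor>real m * y\<rfloor>, l)) / k * ?G
      * (g (real m * x) * g (real m * y))" for x y
      using cell[OF k, of "\<lambda>l. e (\<lfloor>real m * x\<rfloor>, \<lfloor>real m * y\<rfloor>, l) * (g (real m * x) * g (real m * y))"]
      by (simp add: wave_def mult_ac sum_distrib_right sum_distrib_left)
    then show ?thesis by simp
  qed
  also have "\<dots> = (\<integral>x. (\<Sum>j\<in>{0..<int m}. \<Sum>l\<in>{0..<int k}. e (\<lfloor>real m * x\<rfloor>, j, l)) / (real m * real k) * ?G ^ 2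
      * g (real m * x) \<partial>unit_unif)"
  proof -
    have "(\<integral>y. (\<Sum>l\<in>{0..<int k}. e (\<lfloor>real m * x\<rfloor>, \<lfloor>real m * y\<rfloor>, l)) / k * ?G * (g (real m * x) * g (real m * y)) \<partial>unit_unif)
      = (\<Sum>j\<in>{0..<int m}. \<Sum>l\<in>{0..<int k}. e (\<lfloor>real m * x\<rfloor>, j, l)) / (real m * real k) * ?G ^ 2 * g (real m * x)" for x
      using cell[OF m, of "\<lambda>j. (\<Sum>l\<in>{0..<int k}. e (\<lfloor>real m * x\<rfloor>, j, l)) / k * ?G * g (real m * x)"]
      by (simp add: mult_ac power2_eq_square flip: sum_distrib_left sum_divide_distrib)
    then show ?thesis by simp
  qed
  also have "\<dots> = (\<Sum>i\<in>{0..<int m}. \<Sum>j\<in>{0..<int m}. \<Sum>l\<in>{0..<int k}. e (i, j, l)) / (real m * real m * real k) * ?G ^ 3"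
    using cell[OF m, of "\<lambda>i. (\<Sum>j\<in>{0..<int m}. \<Sum>l\<in>{0..<int k}. e (i, j, l)) / (real m * real k) * ?G ^ 2"]
    by (simp add: mult_ac power2_eq_square power3_eq_cube flip: sum_distrib_left sum_divide_distrib)
  also have "(\<Sum>i\<in>{0..<int m}. \<Sum>j\<in>{0..<int m}. \<Sum>l\<in>{0..<int k}. e (i, j, l)) = (\<Sum>c\<in>cells m k. e c)"
    by (simp add: cells_def sum.cartesian_product split_beta')
  finally show ?thesis .
qed

text \<open>Each cell contributes a multiple of the mean of \<open>g\<close>, so the integral over a
  single coordinate vanishes whatever the signs are.\<close>

lemma integral_wave_x:
  assumes "g \<in> borel_measurable borel" "\<And>t. \<bar>g t\<bar> \<le> 1" "\<And>t i. g (t + of_int i) = g t" "0 < m"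
    and "(\<integral>t. g t \<partial>unit_unif) = 0"
  shows "(\<integral>x. wave g m k e (x, y, z) \<partial>unit_unif) = 0" "(\<integral>x. wave g m k e (y, x, z) \<partial>unit_unif) = 0"
  using integral_unit_unif_cells[OF assms(1-4),
      of "\<lambda>i. e (i, \<lfloor>real m * y\<rfloor>, \<lfloor>real k * z\<rfloor>) * (g (real m * y) * g (real k * z))"]
    integral_unit_unif_cells[OF assms(1-4),
      of "\<lambda>i. e (\<lfloor>real m * y\<rfloor>, i, \<lfloor>real k * z\<rfloor>) * (g (real m * y) * g (real k * z))"] assms(5)
  by (simp_all add: wave_def mult_ac)

lemma wave_mult:
  "wave g m k e \<omega> * wave g m k e' \<omega> = wave (\<lambda>t. (g t)\<^sup>2) m k (\<lambda>c. e c * e' c) \<omega>"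
  by (cases \<omega>) (simp add: wave_def power2_eq_square mult_ac)

subsection \<open>Smoothness\<close>

text \<open>If the sign may change between t and u, an integer lies between them, where
  \<open>G\<close> vanishes. Passing through it splits |t - u| exactly, so the Lipschitz constant is
  not even doubled.\<close>

lemma lipschitz_floor_mult:
  fixes G :: "real \<Rightarrow> real" and e :: "int \<Rightarrow> real"
  assumes e: "\<And>i. \<bar>e i\<bar> \<le> 1" and lip: "\<And>t u. \<bar>G t - G u\<bar> \<le> C * \<bar>t - u\<bar>"
    and zero: "\<And>i. G (of_int i) = 0"
  shows "\<bar>e \<lfloor>t\<rfloor> * G t - e \<lfloor>u\<rfloor> * G u\<bar> \<le> C * \<bar>t - u\<bar>"
proof (induction t u rule: linorder_wlog)
  case (le t u)
  show ?case
  proof (cases "\<lfloor>t\<rfloor> = \<lfloor>u\<rfloor>")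
    case True
    have "\<bar>e \<lfloor>u\<rfloor>\<bar> * \<bar>G t - G u\<bar> \<le> 1 * \<bar>G t - G u\<bar>" using e by (intro mult_right_mono) auto
    then show ?thesis using lip[of t u] True by (simp add: abs_mult flip: right_diff_distrib)
  next
    case False
    \<comment> \<open>For t <= u with different floors, the floor of u is an integer between
      them.\<close>
    define i where "i = \<lfloor>u\<rfloor>"
    have i: "t \<le> of_int i" "of_int i \<le> u"
      using le False floor_mono[OF le] unfolding i_def by linarith+
    have "\<bar>e \<lfloor>s\<rfloor> * G s\<bar> \<le> C * \<bar>s - of_int i\<bar>" for s
    proof -
      have "\<bar>e \<lfloor>s\<rfloor>\<bar> * \<bar>G s\<bar> \<le> 1 * \<bar>G s\<bar>" using e by (intro mult_right_mono) auto
      then show ?thesis using lip[of s "of_int i"] zero[of i] by (simp add: abs_mult)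
    qed
    from this[of t] this[of u] have "\<bar>e \<lfloor>t\<rfloor> * G t - e \<lfloor>u\<rfloor> * G u\<bar> \<le> C * \<bar>t - of_int i\<bar> + C * \<bar>u - of_int i\<bar>"
      by linarith
    also have "\<dots> = C * \<bar>t - u\<bar>" using i by (simp add: abs_if algebra_simps)
    finally show ?thesis .
  qed
next
  case (sym t u)
  then show ?case by (simp add: abs_minus_commute)
qed

text \<open>Away from the integers the factor is locally constant. At an integer both
  \<open>G\<close> and \<open>G'\<close> vanish, so the difference quotient tends to 0 and still
  does so after multiplication by a bounded factor.\<close>

lemma has_real_derivative_floor_mult:
  fixes G :: "real \<Rightarrow> real" and e :: "int \<Rightarrow> real"
  assumes e: "\<And>i. \<bar>e i\<bar> \<le> 1" and der: "(G has_real_derivative G' t) (at t)"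
    and zero: "\<And>i. G (of_int i) = 0" "\<And>i. G' (of_int i) = 0"
  shows "((\<lambda>t. e \<lfloor>t\<rfloor> * G t) has_real_derivative e \<lfloor>t\<rfloor> * G' t) (at t)"
proof (cases "t \<in> \<int>")
  case True
  then obtain i where t: "t = of_int i" by (auto elim: Ints_cases)
  have "((\<lambda>s. (G s - G t) / (s - t)) \<longlongrightarrow> 0) (at t)"
    using der zero by (simp add: has_field_derivative_iff t)
  then have g: "((\<lambda>s. \<bar>(G s - G t) / (s - t)\<bar>) \<longlongrightarrow> 0) (at t)"
    by (rule tendsto_rabs_zero)
  have "((\<lambda>s. (e \<lfloor>s\<rfloor> * G s - e \<lfloor>t\<rfloor> * G t) / (s - t)) \<longlongrightarrow> 0) (at t)"
  proof (rule Lim_null_comparison[OF _ g])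
    have "\<bar>e \<lfloor>s\<rfloor>\<bar> * \<bar>G s / (s - t)\<bar> \<le> 1 * \<bar>G s / (s - t)\<bar>" for s
      using e by (intro mult_right_mono) auto
    then show "\<forall>\<^sub>F s in at t. norm ((e \<lfloor>s\<rfloor> * G s - e \<lfloor>t\<rfloor> * G t) / (s - t)) \<le> \<bar>(G s - G t) / (s - t)\<bar>"
      by (simp add: t zero abs_mult)
  qed
  then show ?thesis using zero by (simp add: has_field_derivative_iff t)
next
  case False
  have "((\<lambda>s. e \<lfloor>t\<rfloor> * G s) has_real_derivative e \<lfloor>t\<rfloor> * G' t) (at t)"
    using der by (rule DERIV_cmult)
  then show ?thesis
  proof (rule has_field_derivative_transform_within_open)
    show "open {of_int \<lfloor>t\<rfloor><..<of_int \<lfloor>t\<rfloor> + 1 :: real}" by simp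
    have "real_of_int \<lfloor>t\<rfloor> \<noteq> t" using False by (metis Ints_of_int)
    then have "of_int \<lfloor>t\<rfloor> < t" using of_int_floor_le[of t] by linarith
    then show "t \<in> {of_int \<lfloor>t\<rfloor><..<of_int \<lfloor>t\<rfloor> + 1}"
      using real_of_int_floor_add_one_gt[of t] by auto
    fix s assume "s \<in> {of_int \<lfloor>t\<rfloor><..<of_int \<lfloor>t\<rfloor> + 1 :: real}"
    then have "\<lfloor>s\<rfloor> = \<lfloor>t\<rfloor>" by (simp add: floor_eq_iff)
    then show "e \<lfloor>t\<rfloor> * G s = e \<lfloor>s\<rfloor> * G s" by simp
  qed
qed

lemma strict_floor_bounds:
  assumes "0 < s"
  shows "real (strict_floor s) < s" "s \<le> real (strict_floor s) + 1"
proof -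
  have "0 < \<lceil>s\<rceil>" using assms by simp
  then have "real (strict_floor s) = of_int \<lceil>s\<rceil> - 1"
    by (simp add: strict_floor_def)
  then show "real (strict_floor s) < s" "s \<le> real (strict_floor s) + 1"
    by linarith+
qed

text \<open>Interpolation: a function that is bounded and also Lipschitz at scale 1/m is Hoelder of
  any exponent in (0, 1] at that scale.\<close>

lemma min_1_le_powr:
  fixes u \<sigma> :: real
  assumes "0 \<le> u" "0 < \<sigma>" "\<sigma> \<le> 1"
  shows "min 1 u \<le> u powr \<sigma>"
proof (cases "1 \<le> u")
  case True
  then show ?thesis using assms ge_one_powr_ge_zero[of u \<sigma>] by auto
next
  case False
  have "u powr 1 \<le> u powr \<sigma>" using assms False by (intro powr_mono') auto
  then show ?thesis using assms by simp
qed

text \<open>Differentiating \<open>K\<close> times costs m^K, and the Hoelder modulus of the top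
  derivatives costs a further m^(s-K), since they vary at scale 1/m; together this is a m^s. If K =
  0 the boundedness condition concerns the density itself, including its constant 1, which is why
  \<open>bound0\<close> is a separate condition.\<close>

lemma holder2_wave:
  fixes b :: "nat \<Rightarrow> real \<Rightarrow> real" and e :: "int \<times> int \<times> int \<Rightarrow> real" and s :: real
  defines "K \<equiv> strict_floor s"
  assumes s: "0 < s" and a: "0 \<le> a" and m: "0 < m" and e: "\<And>c. \<bar>e c\<bar> \<le> 1"
    and der: "\<And>j t. j \<le> K \<Longrightarrow> (b j has_real_derivative b (Suc j) t) (at t)"
    and bC: "\<And>j t. j \<le> Suc K \<Longrightarrow> \<bar>b j t\<bar> \<le> C"
    and b_int: "\<And>j i. j \<le> K \<Longrightarrow> b j (of_int i) = 0"
    and b1: "\<And>t. \<bar>b 0 t\<bar> \<le> 1"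
    and bound: "2 * C\<^sup>2 * a * real m powr s \<le> L" and bound0: "K = 0 \<Longrightarrow> 1 + a * C\<^sup>2 \<le> L"
  shows "holder2 s L (\<lambda>x y. 1 + a * wave (b 0) m k e (x, y, z))"
proof -
  define \<sigma> where "\<sigma> = s - real K"
  have \<sigma>: "0 < \<sigma>" "\<sigma> \<le> 1" using strict_floor_bounds[OF s] by (auto simp: \<sigma>_def K_def)
  have C: "0 \<le> C" using bC[of 0 0] by auto
  \<comment> \<open>At fixed z the third bump is a scalar absorbed into the amplitude.\<close>
  define A where "A = a * b 0 (real k * z)"
  have A: "\<bar>A\<bar> \<le> a" using b1[of "real k * z"] a mult_left_mono[of "\<bar>b 0 (real k * z)\<bar>" 1 a] by (simp add: A_def abs_mult)
  define E where "E i j = e (i, j, \<lfloor>real k * z\<rfloor>)" for i j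
  have E: "\<bar>E i j\<bar> \<le> 1" for i j by (simp add: E_def e)
  \<comment> \<open>The constant 1 contributes only to the derivative of order 0.\<close>
  define D where "D j l x y = (if j = 0 \<and> l = 0 then 1 else 0)
      + A * real m ^ (j + l) * (E \<lfloor>real m * x\<rfloor> \<lfloor>real m * y\<rfloor> * (b j (real m * x) * b l (real m * y)))" for j l x y
  have lip: "\<bar>b j t - b j u\<bar> \<le> C * \<bar>t - u\<bar>" if "j \<le> K" for j t u
    using field_differentiable_bound[of UNIV "b j" "b (Suc j)" C t u] der[OF that] bC[of "Suc j"] that by auto
  have dx: "((\<lambda>t. D j l t y) has_real_derivative D (Suc j) l x y) (at x)" if "j + l < K" for j l x y
  proof -
    have "((\<lambda>t. E \<lfloor>t\<rfloor> \<lfloor>real m * y\<rfloor> * b j t) has_real_derivative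
        E \<lfloor>real m * x\<rfloor> \<lfloor>real m * y\<rfloor> * b (Suc j) (real m * x)) (at (real m * x))"
      using that by (intro has_real_derivative_floor_mult[of "\<lambda>i. E i \<lfloor>real m * y\<rfloor>"] E der b_int) auto
    from DERIV_chain2[where f="\<lambda>t. E \<lfloor>t\<rfloor> \<lfloor>real m * y\<rfloor> * b j t" and g="\<lambda>t. real m * t" and x=x and s=UNIV and Db="real m", OF this]
    have "((\<lambda>t. E \<lfloor>real m * t\<rfloor> \<lfloor>real m * y\<rfloor> * b j (real m * t)) has_real_derivative
        E \<lfloor>real m * x\<rfloor> \<lfloor>real m * y\<rfloor> * b (Suc j) (real m * x) * real m) (at x)"
      by (auto intro!: derivative_eq_intros)
    from DERIV_add[OF DERIV_const DERIV_cmult[OF this, of "A * real m ^ (j + l) * b l (real m * y)"]]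
    show ?thesis by (simp add: D_def mult_ac)
  qed
  have dy: "((\<lambda>t. D j l x t) has_real_derivative D j (Suc l) x y) (at y)" if "j + l < K" for j l x y
  proof -
    have "((\<lambda>t. E \<lfloor>real m * x\<rfloor> \<lfloor>t\<rfloor> * b l t) has_real_derivative
        E \<lfloor>real m * x\<rfloor> \<lfloor>real m * y\<rfloor> * b (Suc l) (real m * y)) (at (real m * y))"
      using that by (intro has_real_derivative_floor_mult[of "\<lambda>i. E \<lfloor>real m * x\<rfloor> i"] E der b_int) auto
    from DERIV_chain2[where f="\<lambda>t. E \<lfloor>real m * x\<rfloor> \<lfloor>t\<rfloor> * b l t" and g="\<lambda>t. real m * t" and x=y and s=UNIV and Db="real m", OF this]
    have "((\<lambda>t. E \<lfloor>real m * x\<rfloor> \<lfloor>real m * t\<rfloor> * b l (real m * t)) has_real_derivative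
        E \<lfloor>real m * x\<rfloor> \<lfloor>real m * y\<rfloor> * b (Suc l) (real m * y) * real m) (at y)"
      by (auto intro!: derivative_eq_intros)
    from DERIV_add[OF DERIV_const DERIV_cmult[OF this, of "A * real m ^ (j + l) * b j (real m * x)"]]
    show ?thesis by (simp add: D_def mult_ac)
  qed
  define P where "P j x y = E \<lfloor>real m * x\<rfloor> \<lfloor>real m * y\<rfloor> * (b j (real m * x) * b (K - j) (real m * y))" for j x y
  have PC: "\<bar>P j x y\<bar> \<le> C\<^sup>2" if "j \<le> K" for j x y
  proof -
    have "\<bar>P j x y\<bar> \<le> 1 * (C * C)"
      unfolding P_def abs_mult using that C E bC by (intro mult_mono) auto
    then show ?thesis by (simp add: power2_eq_square)
  qed
  have scale: "\<bar>real m * u - real m * v\<bar> = real m * \<bar>u - v\<bar>" for u v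
    by (simp add: abs_mult flip: right_diff_distrib)
  have Px: "\<bar>P j x y - P j x' y\<bar> \<le> C\<^sup>2 * (real m * \<bar>x - x'\<bar>)" if j: "j \<le> K" for j x x' y
  proof -
    have "\<bar>E \<lfloor>real m * x\<rfloor> \<lfloor>real m * y\<rfloor> * b j (real m * x) - E \<lfloor>real m * x'\<rfloor> \<lfloor>real m * y\<rfloor> * b j (real m * x')\<bar>
        \<le> C * (real m * \<bar>x - x'\<bar>)"
      using j unfolding scale[symmetric] by (intro lipschitz_floor_mult[of "\<lambda>i. E i \<lfloor>real m * y\<rfloor>"] E lip b_int)
    then have "\<bar>E \<lfloor>real m * x\<rfloor> \<lfloor>real m * y\<rfloor> * b j (real m * x) - E \<lfloor>real m * x'\<rfloor> \<lfloor>real m * y\<rfloor> * b j (real m * x')\<bar>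
        * \<bar>b (K - j) (real m * y)\<bar> \<le> C * (real m * \<bar>x - x'\<bar>) * C"
      using C bC by (intro mult_mono) auto
    moreover have "P j x y - P j x' y = (E \<lfloor>real m * x\<rfloor> \<lfloor>real m * y\<rfloor> * b j (real m * x)
        - E \<lfloor>real m * x'\<rfloor> \<lfloor>real m * y\<rfloor> * b j (real m * x')) * b (K - j) (real m * y)"
      by (simp add: P_def algebra_simps)
    moreover have "C * (real m * \<bar>x - x'\<bar>) * C = C\<^sup>2 * (real m * \<bar>x - x'\<bar>)"
      by (simp add: power2_eq_square)
    ultimately show ?thesis by (simp only: abs_mult)
  qed
  have Py: "\<bar>P j x y - P j x y'\<bar> \<le> C\<^sup>2 * (real m * \<bar>y - y'\<bar>)" if j: "j \<le> K" for j x y y'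
  proof -
    have "\<bar>E \<lfloor>real m * x\<rfloor> \<lfloor>real m * y\<rfloor> * b (K - j) (real m * y) - E \<lfloor>real m * x\<rfloor> \<lfloor>real m * y'\<rfloor> * b (K - j) (real m * y')\<bar>
        \<le> C * (real m * \<bar>y - y'\<bar>)"
      using j unfolding scale[symmetric] by (intro lipschitz_floor_mult[of "\<lambda>i. E \<lfloor>real m * x\<rfloor> i"] E lip b_int) auto
    then have "\<bar>E \<lfloor>real m * x\<rfloor> \<lfloor>real m * y\<rfloor> * b (K - j) (real m * y) - E \<lfloor>real m * x\<rfloor> \<lfloor>real m * y'\<rfloor> * b (K - j) (real m * y')\<bar>
        * \<bar>b j (real m * x)\<bar> \<le> C * (real m * \<bar>y - y'\<bar>) * C"
      using C bC j by (intro mult_mono) auto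
    moreover have "P j x y - P j x y' = (E \<lfloor>real m * x\<rfloor> \<lfloor>real m * y\<rfloor> * b (K - j) (real m * y)
        - E \<lfloor>real m * x\<rfloor> \<lfloor>real m * y'\<rfloor> * b (K - j) (real m * y')) * b j (real m * x)"
      by (simp add: P_def algebra_simps)
    moreover have "C * (real m * \<bar>y - y'\<bar>) * C = C\<^sup>2 * (real m * \<bar>y - y'\<bar>)"
      by (simp add: power2_eq_square)
    ultimately show ?thesis by (simp only: abs_mult)
  qed
  have top: "D j (K - j) x y = (if K = 0 then 1 else 0) + A * real m ^ K * P j x y" if "j \<le> K" for j x y
    using that by (auto simp: D_def P_def)
  have mK: "real m ^ K \<le> real m powr s"
  proof -
    have "real m ^ K = real m powr real K" using m by (simp add: powr_realpow)
    also have "\<dots> \<le> real m powr s" using m \<sigma> by (intro powr_mono) (auto simp: \<sigma>_def)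
    finally show ?thesis .
  qed
  have hoelder: "\<bar>D j (K - j) x y - D j (K - j) x' y'\<bar> \<le> L * ((x - x')\<^sup>2 + (y - y')\<^sup>2) powr (\<sigma> / 2)"
    if j: "j \<le> K" for j x y x' y'
  proof -
    define d where "d = sqrt ((x - x')\<^sup>2 + (y - y')\<^sup>2)"
    have d: "\<bar>x - x'\<bar> \<le> d" "\<bar>y - y'\<bar> \<le> d" "0 \<le> d"
      by (auto simp: d_def real_le_rsqrt)
    have "\<bar>P j x y - P j x' y'\<bar> \<le> C\<^sup>2 * (real m * \<bar>x - x'\<bar>) + C\<^sup>2 * (real m * \<bar>y - y'\<bar>)"
      using Px[OF j, of x y x'] Py[OF j, of x' y y'] by linarith
    also have "\<dots> \<le> C\<^sup>2 * (real m * d) + C\<^sup>2 * (real m * d)"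
      using d by (intro add_mono mult_left_mono) auto
    finally have 1: "\<bar>P j x y - P j x' y'\<bar> \<le> 2 * C\<^sup>2 * (real m * d)" by (simp add: mult_ac)
    have 2: "\<bar>P j x y - P j x' y'\<bar> \<le> 2 * C\<^sup>2 * 1"
      using PC[OF j, of x y] PC[OF j, of x' y'] by linarith
    have "\<bar>P j x y - P j x' y'\<bar> \<le> 2 * C\<^sup>2 * min 1 (real m * d)"
      using 1 2 by (auto simp: min_def)
    also have "\<dots> \<le> 2 * C\<^sup>2 * (real m * d) powr \<sigma>"
      using d \<sigma> by (intro mult_left_mono min_1_le_powr) auto
    finally have P: "\<bar>P j x y - P j x' y'\<bar> \<le> 2 * C\<^sup>2 * (real m powr \<sigma> * d powr \<sigma>)"
      using d by (simp add: powr_mult)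
    have "\<bar>D j (K - j) x y - D j (K - j) x' y'\<bar> = \<bar>A\<bar> * real m ^ K * \<bar>P j x y - P j x' y'\<bar>"
      by (simp add: top[OF j] abs_mult flip: right_diff_distrib)
    also have "\<dots> \<le> a * real m ^ K * (2 * C\<^sup>2 * (real m powr \<sigma> * d powr \<sigma>))"
      using A a P by (intro mult_mono) auto
    also have "\<dots> = 2 * C\<^sup>2 * a * (real m powr real K * real m powr \<sigma>) * d powr \<sigma>"
      using m by (simp add: powr_realpow)
    also have "real m powr real K * real m powr \<sigma> = real m powr s"
      by (simp add: \<sigma>_def flip: powr_add)
    also have "2 * C\<^sup>2 * a * real m powr s * d powr \<sigma> \<le> L * d powr \<sigma>"
      using bound by (intro mult_right_mono) auto
    also have "d powr \<sigma> = ((x - x')\<^sup>2 + (y - y')\<^sup>2) powr (\<sigma> / 2)"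
      by (simp add: d_def powr_half_sqrt[symmetric] powr_powr)
    finally show ?thesis .
  qed
  have bounded: "\<bar>D j (K - j) x y\<bar> \<le> L" if j: "j \<le> K" for j x y
  proof -
    have AP: "\<bar>A * real m ^ K * P j x y\<bar> \<le> a * real m ^ K * C\<^sup>2"
      unfolding abs_mult using A a PC[OF j] by (intro mult_mono) auto
    show ?thesis
    proof (cases "K = 0")
      case True
      then have "\<bar>A * P j x y\<bar> \<le> a * C\<^sup>2" using AP by simp
      then show ?thesis using bound0[OF True] top[OF j, of x y] True by simp
    next
      case False
      have "a * real m ^ K * C\<^sup>2 \<le> a * real m powr s * C\<^sup>2"
        using mK a by (intro mult_mono) auto
      also have "\<dots> \<le> 2 * C\<^sup>2 * a * real m powr s" using a by (simp add: mult_ac)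
      finally show ?thesis using AP bound False by (simp add: top[OF j])
    qed
  qed
  show ?thesis
    unfolding holder2_def
  proof (intro exI[of _ D] conjI allI impI ballI)
    fix x y
    show "D 0 0 x y = 1 + a * wave (b 0) m k e (x, y, z)"
      by (simp add: D_def wave_def A_def E_def)
  qed (use dx dy hoelder bounded in \<open>auto simp: K_def \<sigma>_def intro: has_field_derivative_at_within\<close>)
qed

subsection \<open>The perturbed laws\<close>

text \<open>Applied with the small amplitude to the perturbed density, and with amplitude 1 to the
  function \<open>h\<close> of the separation argument.\<close>

lemma nn_integral_one_plus_wave:
  assumes g [measurable]: "g \<in> borel_measurable borel" and g1: "\<And>t. \<bar>g t\<bar> \<le> 1"
    and per: "\<And>t i. g (t + of_int i) = g t" and mean: "(\<integral>t. g t \<partial>unit_unif) = 0"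
    and e: "\<And>c. \<bar>e c\<bar> \<le> 1" and m: "0 < m" and a: "0 \<le> a" "a \<le> 1"
  shows "(\<integral>\<^sup>+x. ennreal (1 + a * wave g m k e (x, y, z)) \<partial>unit_unif) = 1"
    and "(\<integral>\<^sup>+y. ennreal (1 + a * wave g m k e (x, y, z)) \<partial>unit_unif) = 1"
proof -
  have w: "\<bar>wave g m k e \<omega>\<bar> \<le> 1" for \<omega> using g1 e by (rule wave_bounded)
  have aw: "0 \<le> 1 + a * wave g m k e \<omega>" for \<omega>
  proof -
    have "\<bar>a * wave g m k e \<omega>\<bar> \<le> 1 * 1" unfolding abs_mult using a w by (intro mult_mono) auto
    then show ?thesis by linarith
  qed
  note [measurable] = wave_measurable[OF g]
  have gen: "(\<integral>\<^sup>+t. ennreal (1 + a * wave g m k e (h t)) \<partial>unit_unif) = 1"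
    if [measurable]: "h \<in> borel \<rightarrow>\<^sub>M borel \<Otimes>\<^sub>M (borel \<Otimes>\<^sub>M borel)"
      and 0: "(\<integral>t. wave g m k e (h t) \<partial>unit_unif) = 0" for h
  proof -
    have int: "integrable unit_unif (\<lambda>t. wave g m k e (h t))"
      using w by (intro U.integrable_const_bound[of _ 1]) auto
    then have "(\<integral>\<^sup>+t. ennreal (1 + a * wave g m k e (h t)) \<partial>unit_unif)
        = ennreal (\<integral>t. 1 + a * wave g m k e (h t) \<partial>unit_unif)"
      using aw by (intro nn_integral_eq_integral) auto
    also have "(\<integral>t. 1 + a * wave g m k e (h t) \<partial>unit_unif) = 1"
      using int by (simp add: 0 U.prob_space[simplified])
    finally show ?thesis by simp
  qed
  show "(\<integral>\<^sup>+x. ennreal (1 + a * wave g m k e (x, y, z)) \<partial>unit_unif) = 1"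
    using integral_wave_x(1)[OF g g1 per m mean] by (intro gen) auto
  show "(\<integral>\<^sup>+y. ennreal (1 + a * wave g m k e (x, y, z)) \<partial>unit_unif) = 1"
    using integral_wave_x(2)[OF g g1 per m mean] by (intro gen) auto
qed

locale wave_density =
  fixes g :: "real \<Rightarrow> real" and m k :: nat and a :: real
  assumes g [measurable]: "g \<in> borel_measurable borel" and g1: "\<And>t. \<bar>g t\<bar> \<le> 1"
    and per: "\<And>t i. g (t + of_int i) = g t" and mean: "(\<integral>t. g t \<partial>unit_unif) = 0"
    and m: "0 < m" and k: "0 < k" and a: "0 \<le> a" "a \<le> 1"
begin

abbreviation perturbed :: "(int \<times> int \<times> int) set \<Rightarrow> triple \<Rightarrow> real" where
  "perturbed A \<omega> \<equiv> 1 + a * wave g m k (sign_of A) \<omega>"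

abbreviation perturbed_law :: "(int \<times> int \<times> int) set \<Rightarrow> triple measure" where
  "perturbed_law A \<equiv> density unit_cube_unif (\<lambda>\<omega>. ennreal (perturbed A \<omega>))"

lemma abs_sign_of: "\<bar>sign_of A c\<bar> \<le> 1" by (simp add: sign_of_def)

lemma abs_wave: "\<bar>wave g m k (sign_of A) \<omega>\<bar> \<le> 1"
  using g1 abs_sign_of by (rule wave_bounded)

lemma wave_meas [measurable]: "wave g m k e \<in> borel_measurable (borel \<Otimes>\<^sub>M (borel \<Otimes>\<^sub>M borel))"
  by (rule wave_measurable[OF g])

lemma perturbed_bounds: "0 \<le> perturbed A \<omega>" "perturbed A \<omega> \<le> 2"
proof -
  have "\<bar>a * wave g m k (sign_of A) \<omega>\<bar> \<le> 1 * 1" unfolding abs_mult using a abs_wave by (intro mult_mono) auto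
  then show "0 \<le> perturbed A \<omega>" "perturbed A \<omega> \<le> 2" by linarith+
qed

lemma section_density_perturbed: "section_density (\<lambda>\<omega>. ennreal (perturbed A \<omega>))"
  by standard
    (auto simp: nn_integral_one_plus_wave(2)[OF g g1 per mean abs_sign_of m a] U.emeasure_space_1[simplified])

sublocale P: section_density "\<lambda>\<omega>. ennreal (perturbed A \<omega>)" for A
  by (rule section_density_perturbed)

lemma integrable_wave: "integrable unit_cube_unif (wave g m k (sign_of A))"
  using abs_wave by (intro U3.integrable_const_bound[of _ 1]) auto

lemma integrable_wave_mult:
  "integrable unit_cube_unif (\<lambda>\<omega>. wave g m k (sign_of A) \<omega> * wave g m k (sign_of B) \<omega>)"
proof (intro U3.integrable_const_bound[of _ "1 * 1"] AE_I2)
  fix \<omega> show "norm (wave g m k (sign_of A) \<omega> * wave g m k (sign_of B) \<omega>) \<le> 1 * 1"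
    unfolding real_norm_def abs_mult using abs_wave by (intro mult_mono) auto
qed measurable

lemma integral_wave_0: "(\<integral>\<omega>. wave g m k (sign_of A) \<omega> \<partial>unit_cube_unif) = 0"
  using integral_wave[OF g g1 per abs_sign_of m k] by (simp add: mean)

lemma integral_wave_mult:
  "(\<integral>\<omega>. wave g m k (sign_of A) \<omega> * wave g m k (sign_of B) \<omega> \<partial>unit_cube_unif)
    = (\<Sum>c\<in>cells m k. sign_of A c * sign_of B c) / (real m * real m * real k)
      * (\<integral>t. (g t)\<^sup>2 \<partial>unit_unif) ^ 3"
  unfolding wave_mult
  by (rule integral_wave) (auto simp: per m k sign_of_def abs_square_le_1 g1)

lemma integral_perturbed: "(\<integral>\<omega>. perturbed A \<omega> \<partial>unit_cube_unif) = 1"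
  using integrable_wave by (simp add: integral_wave_0 U3.prob_space[simplified])

text \<open>With c = d = a this gives the second moments of the likelihood ratios; with d = 1 and A
  = B it gives the expectation of \<open>h\<close> under a perturbed law.\<close>

lemma integral_perturbed_mult:
  "(\<integral>\<omega>. (1 + c * wave g m k (sign_of A) \<omega>) * (1 + d * wave g m k (sign_of B) \<omega>) \<partial>unit_cube_unif)
    = 1 + c * d * (\<integral>\<omega>. wave g m k (sign_of A) \<omega> * wave g m k (sign_of B) \<omega> \<partial>unit_cube_unif)"
proof -
  have "(\<lambda>\<omega>. (1 + c * wave g m k (sign_of A) \<omega>) * (1 + d * wave g m k (sign_of B) \<omega>))
      = (\<lambda>\<omega>. 1 + c * wave g m k (sign_of A) \<omega> + d * wave g m k (sign_of B) \<omega>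
          + c * d * (wave g m k (sign_of A) \<omega> * wave g m k (sign_of B) \<omega>))"
    by (simp add: fun_eq_iff algebra_simps)
  then show ?thesis
    using integrable_wave integrable_wave_mult by (simp add: integral_wave_0 U3.prob_space[simplified])
qed

lemma l1_dist_perturbed_ge:
  assumes q: "q \<in> P0"
  shows "ennreal (a * (\<integral>t. (g t)\<^sup>2 \<partial>unit_unif) ^ 3 / 4) \<le> l1_dist (perturbed_law A) q"
proof (cases "l1_dist (perturbed_law A) q")
  case (real r)
  let ?I = "\<integral>t. (g t)\<^sup>2 \<partial>unit_unif"
  let ?h = "\<lambda>\<omega>. ennreal (1 + 1 * wave g m k (sign_of A) \<omega>)"
  have h0: "0 \<le> 1 + 1 * wave g m k (sign_of A) \<omega>" "1 + 1 * wave g m k (sign_of A) \<omega> \<le> 2" for \<omega>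
    using abs_wave[of A \<omega>] by linarith+
  \<comment> \<open>\<open>h\<close> carries the same signs as the density, so all boxes contribute
    with the same sign and none cancel.\<close>
  have "(\<Sum>c\<in>cells m k. sign_of A c * sign_of A c) = (\<Sum>c\<in>cells m k. 1)"
    by (intro sum.cong) (auto simp: sign_of_def)
  then have sq: "(\<integral>\<omega>. wave g m k (sign_of A) \<omega> * wave g m k (sign_of A) \<omega> \<partial>unit_cube_unif) = ?I ^ 3"
    using m k by (simp add: integral_wave_mult card_cells)
  have "(\<integral>\<^sup>+\<omega>. ?h \<omega> \<partial>perturbed_law A) = (\<integral>\<^sup>+\<omega>. ennreal (perturbed A \<omega>) * ?h \<omega> \<partial>unit_cube_unif)"
    by (subst nn_integral_density) auto
  also have "\<dots> = (\<integral>\<^sup>+\<omega>. ennreal (perturbed A \<omega> * (1 + 1 * wave g m k (sign_of A) \<omega>)) \<partial>unit_cube_unif)"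
    using perturbed_bounds h0 by (intro nn_integral_cong) (simp only: ennreal_mult)
  also have "\<dots> = ennreal (\<integral>\<omega>. perturbed A \<omega> * (1 + 1 * wave g m k (sign_of A) \<omega>) \<partial>unit_cube_unif)"
  proof (intro nn_integral_eq_integral U3.integrable_const_bound[of _ "2 * 2"] AE_I2)
    fix \<omega>
    show "norm (perturbed A \<omega> * (1 + 1 * wave g m k (sign_of A) \<omega>)) \<le> 2 * 2"
      unfolding real_norm_def abs_mult using perturbed_bounds h0 by (intro mult_mono) (auto simp: abs_of_nonneg)
    show "0 \<le> perturbed A \<omega> * (1 + 1 * wave g m k (sign_of A) \<omega>)"
      using perturbed_bounds h0 by (intro mult_nonneg_nonneg)
  qed measurable
  also have "\<dots> = ennreal (1 + a * ?I ^ 3)"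
    unfolding integral_perturbed_mult sq by simp
  finally have eq: "(\<integral>\<^sup>+\<omega>. ?h \<omega> \<partial>perturbed_law A) = ennreal (1 + a * ?I ^ 3)" .
  have "(\<integral>\<^sup>+\<omega>. ?h \<omega> \<partial>perturbed_law A) \<le> 1 + 4 * l1_dist (perturbed_law A) q"
  proof (rule nn_integral_le_l1_dist_P0[OF _ _ _ _ _ q])
    show "?h \<omega> \<le> 2" for \<omega> using ennreal_leI[OF h0(2)[of \<omega>]] by simp
    show "(\<integral>\<^sup>+x. ?h (x, y, z) \<partial>unit_unif) = 1" for y z
      by (rule nn_integral_one_plus_wave(1)[OF g g1 per mean abs_sign_of m]) auto
    show "(\<integral>\<^sup>+y. ennreal (perturbed A (x, y, z)) \<partial>unit_unif) = 1" for x z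
      by (rule nn_integral_one_plus_wave(2)[OF g g1 per mean abs_sign_of m a])
  qed measurable
  also have "\<dots> = ennreal (1 + 4 * r)"
    using real by (simp add: ennreal_mult)
  finally have "1 + a * ?I ^ 3 \<le> 1 + 4 * r"
    unfolding eq using real by (subst (asm) ennreal_le_iff) auto
  then show ?thesis using real by (auto intro!: ennreal_leI)
qed auto

text \<open>A member of \<open>P0\<close> would be at distance 0 from itself, against the positive
  lower bound.\<close>

lemma perturbed_law_in_Q0:
  assumes "0 < a" "0 < (\<integral>t. (g t)\<^sup>2 \<partial>unit_unif)"
  shows "perturbed_law A \<in> Q0"
proof -
  have "perturbed_law A \<notin> P0"
  proof
    assume "perturbed_law A \<in> P0"
    moreover have "0 < a * (\<integral>t. (g t)\<^sup>2 \<partial>unit_unif) ^ 3" using assms by simp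
    ultimately show False
      using l1_dist_perturbed_ge[of "perturbed_law A" A] by (simp add: ennreal_eq_0_iff not_le)
  qed
  then show ?thesis using P.law_in_E0 by (simp add: Q0_def)
qed

text \<open>The bound already holds pointwise in (x, y), where the other two bumps are at most 1,
  and the unit square has mass 1.\<close>

lemma l1_dist_kernel_le:
  assumes lip: "\<And>t u. \<bar>g t - g u\<bar> \<le> C * \<bar>t - u\<bar>" and zero: "\<And>i. g (of_int i) = 0"
  shows "l1_dist (P.kernel A z) (P.kernel A z') \<le> ennreal (a * C * real k * \<bar>z - z'\<bar>)"
proof -
  have meas: "(\<lambda>w. perturbed A (fst w, snd w, z)) \<in> borel_measurable unit_square_unif" for z
    by measurable
  have fin: "finite_measure (density unit_square_unif (\<lambda>w. ennreal (perturbed A (fst w, snd w, z))))" for z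
    using prob_space.finite_measure[OF P.prob_space_kernel[of A z]] by (simp only: P.kernel_def)
  have pt: "\<bar>perturbed A (x, y, z) - perturbed A (x, y, z')\<bar> \<le> a * C * real k * \<bar>z - z'\<bar>" for x y
  proof -
    let ?e = "\<lambda>i. sign_of A (\<lfloor>real m * x\<rfloor>, \<lfloor>real m * y\<rfloor>, i)"
    have "\<bar>?e \<lfloor>real k * z\<rfloor> * g (real k * z) - ?e \<lfloor>real k * z'\<rfloor> * g (real k * z')\<bar> \<le> C * \<bar>real k * z - real k * z'\<bar>"
      by (intro lipschitz_floor_mult abs_sign_of lip zero)
    also have "\<bar>real k * z - real k * z'\<bar> = real k * \<bar>z - z'\<bar>"
      by (simp add: abs_mult flip: right_diff_distrib)
    finally have 1: "\<bar>?e \<lfloor>real k * z\<rfloor> * g (real k * z) - ?e \<lfloor>real k * z'\<rfloor> * g (real k * z')\<bar> \<le> C * (real k * \<bar>z - z'\<bar>)" .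
    have "perturbed A (x, y, z) - perturbed A (x, y, z') = a * (g (real m * x) * g (real m * y))
        * (?e \<lfloor>real k * z\<rfloor> * g (real k * z) - ?e \<lfloor>real k * z'\<rfloor> * g (real k * z'))"
      by (simp add: wave_def right_diff_distrib mult_ac)
    also have "\<bar>\<dots>\<bar> \<le> (a * (1 * 1)) * (C * (real k * \<bar>z - z'\<bar>))"
      unfolding abs_mult using a g1 1 by (intro mult_mono) auto
    finally show ?thesis by (simp add: mult_ac)
  qed
  have "l1_dist (P.kernel A z) (P.kernel A z')
      \<le> (\<integral>\<^sup>+w. ennreal \<bar>perturbed A (fst w, snd w, z) - perturbed A (fst w, snd w, z')\<bar> \<partial>unit_square_unif)"
    unfolding P.kernel_def
    by (rule l1_dist_density_le[OF meas meas perturbed_bounds(1) perturbed_bounds(1) fin fin])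
  also have "\<dots> \<le> (\<integral>\<^sup>+w. ennreal (a * C * real k * \<bar>z - z'\<bar>) \<partial>unit_square_unif)"
    by (intro nn_integral_mono ennreal_leI pt)
  also have "\<dots> = ennreal (a * C * real k * \<bar>z - z'\<bar>)"
    by (simp add: U2.emeasure_space_1[simplified])
  finally show ?thesis .
qed

lemma kernel_eq_density:
  "P.kernel A z = density lborel (\<lambda>(x, y). ennreal (perturbed A (x, y, z)) * indicator ({0..1} \<times> {0..1}) (x, y))"
proof -
  have "(\<lambda>w. ennreal (perturbed A (fst w, snd w, z))) \<in> borel_measurable (borel \<Otimes>\<^sub>M borel)"
    by measurable
  then have 1: "(\<lambda>w. ennreal (perturbed A (fst w, snd w, z))) \<in> borel_measurable lborel"
    by (simp only: measurable_cong_sets[OF sets_lborel refl] measurable_cong_sets[OF sets_borel_pair refl])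
  have 2: "indicator ({0..1} \<times> {0..1}) \<in> borel_measurable (lborel :: (real \<times> real) measure)"
    by (intro borel_measurable_indicator) (simp add: unit_square_cube_measurable)
  have "P.kernel A z = density lborel (\<lambda>w. indicator ({0..1} \<times> {0..1}) w * ennreal (perturbed A (fst w, snd w, z)))"
    unfolding P.kernel_def unit_square_unif_eq_density by (rule density_density_eq[OF 2 1])
  also have "(\<lambda>w. indicator ({0..1} \<times> {0..1}) w * ennreal (perturbed A (fst w, snd w, z)))
      = (\<lambda>(x, y). ennreal (perturbed A (x, y, z)) * indicator ({0..1} \<times> {0..1}) (x, y))"
    by (rule ext) (simp only: split_beta' prod.collapse mult.commute)
  finally show ?thesis .
qed

end

text \<open>Measurability of \<open>f\<close> is not assumed: if the set function fails to be a
  measure, \<open>density\<close> assigns 0. This allows the conditional densities in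
  \<open>Q0_TV\<close> to be compared with the uniform one without first proving them
  measurable.\<close>

lemma emeasure_density_le: "emeasure (density M f) A \<le> (\<integral>\<^sup>+x. f x * indicator A x \<partial>M)"
  by (simp add: density_def emeasure_measure_of_conv)

text \<open>Applying the inequality to complements reverses it, because both total masses are
  1.\<close>

lemma prob_space_eqI_le:
  assumes "prob_space M" "prob_space N" and sets: "sets M = sets N"
    and le: "\<And>A. A \<in> sets N \<Longrightarrow> emeasure M A \<le> emeasure N A"
  shows "M = N"
proof (rule measure_eqI)
  interpret M: prob_space M by fact
  interpret N: prob_space N by fact
  fix A assume A: "A \<in> sets M"
  have sp: "space M = space N" using sets by (rule sets_eq_imp_space_eq)
  have "measure M (space M - A) \<le> measure N (space N - A)"
    using le[of "space N - A"] A sets by (simp add: M.emeasure_eq_measure N.emeasure_eq_measure sp)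
  then have "measure N A \<le> measure M A"
    using A sets by (simp add: M.prob_compl N.prob_compl)
  moreover have "measure M A \<le> measure N A"
    using le[of A] A sets by (simp add: M.emeasure_eq_measure N.emeasure_eq_measure)
  ultimately show "emeasure M A = emeasure N A"
    by (simp add: M.emeasure_eq_measure N.emeasure_eq_measure)
qed fact

text \<open>The kernel is controlled only for z in the unit interval, but Z lies there almost
  surely, so it can be replaced by a constant kernel, which is a product.\<close>

lemma P0_if_kernel_uniform:
  assumes p: "p \<in> E0" and \<kappa>: "cond_distr p XY_of \<kappa>"
    and unif: "\<And>z. z \<in> {0..1} \<Longrightarrow> \<kappa> z = unit_square_unif"
  shows "p \<in> P0"
proof -
  have "prob_space p" and sp: "sets p = sets borel" and cube: "emeasure p ({0..1} \<times> {0..1} \<times> {0..1}) = 1"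
    using p by (auto simp: E0_def)
  interpret prob_space p by fact
  have Z: "Z_of \<in> p \<rightarrow>\<^sub>M borel"
    using Z_of_measurable by (simp add: measurable_cong_sets[OF sp refl] borel_prod)
  have "AE \<omega> in p. \<omega> \<in> {0..1} \<times> {0..1} \<times> {0..1}"
    by (rule AE_prob_1) (simp add: measure_def cube)
  then have "AE \<omega> in p. Z_of \<omega> \<in> {0..1}" by eventually_elim auto
  then have AEZ: "AE z in distr p borel Z_of. z \<in> {0..1}"
    using Z by (subst AE_distr_iff) auto
  have eq: "emeasure p {\<omega> \<in> space p. XY_of \<omega> \<in> A \<and> Z_of \<omega> \<in> B}
      = (\<integral>\<^sup>+z\<in>B. emeasure unit_square_unif A \<partial>distr p borel Z_of)"
    if "A \<in> sets borel" "B \<in> sets borel" for A B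
  proof -
    have "emeasure p {\<omega> \<in> space p. XY_of \<omega> \<in> A \<and> Z_of \<omega> \<in> B}
        = (\<integral>\<^sup>+z\<in>B. emeasure (\<kappa> z) A \<partial>distr p borel Z_of)"
      using \<kappa> that by (simp add: cond_distr_def)
    also have "\<dots> = (\<integral>\<^sup>+z\<in>B. emeasure unit_square_unif A \<partial>distr p borel Z_of)"
      using AEZ by (intro nn_integral_cong_AE, eventually_elim) (simp add: unif)
    finally show ?thesis .
  qed
  have "cond_distr p XY_of (\<lambda>_. unit_unif \<Otimes>\<^sub>M unit_unif)"
    unfolding cond_distr_def unit_square_unif_def[symmetric]
  proof (intro conjI ballI eq measurable_const)
    show "unit_square_unif \<in> space (prob_algebra borel)"
      by (simp add: space_prob_algebra U2.prob_space_axioms sets_unit_square_unif sets_borel_pair)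
  qed
  then show ?thesis
    unfolding P0_def cond_indep_XY_given_Z_def using p cond_distr_uniform_marginals by blast
qed

text \<open>With L <= 1 each conditional density would be at most 1 on the square, hence each
  conditional law would be dominated by the uniform one and equal to it. X and Y would then be
  conditionally independent, a contradiction. This provides the room L - 1 in which the perturbation
  fits.\<close>

lemma Q0_TV_nonempty_imp:
  assumes ne: "Q0_TV L s \<noteq> {}" and s0: "strict_floor s = 0"
  shows "1 < L"
proof (rule ccontr)
  assume "\<not> 1 < L"
  then have L: "L \<le> 1" by simp
  obtain p \<kappa> where p: "p \<in> Q0" and \<kappa>: "cond_distr p XY_of \<kappa>"
    and dens: "\<And>z. z \<in> {0..1} \<Longrightarrow> \<exists>f. holder2 s L f \<and> (\<forall>x\<in>{0..1}. \<forall>y\<in>{0..1}. 0 \<le> f x y) \<and>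
        \<kappa> z = density lborel (\<lambda>(x, y). ennreal (f x y) * indicator ({0..1} \<times> {0..1}) (x, y))"
    using ne by (auto simp: Q0_TV_def)
  have k: "\<kappa> \<in> borel \<rightarrow>\<^sub>M prob_algebra borel" using \<kappa> by (simp add: cond_distr_def)
  have "\<kappa> z = unit_square_unif" if z: "z \<in> {0..1}" for z
  proof -
    obtain f where f: "holder2 s L f"
      and \<kappa>z: "\<kappa> z = density lborel (\<lambda>(x, y). ennreal (f x y) * indicator ({0..1} \<times> {0..1}) (x, y))"
      using dens[OF z] by auto
    \<comment> \<open>With \<open>strict_floor s = 0\<close> the only top-order derivative is
      \<open>f\<close> itself.\<close>
    obtain D where D0: "\<And>x y. x \<in> {0..1} \<Longrightarrow> y \<in> {0..1} \<Longrightarrow> D 0 0 x y = f x y"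
      and DL: "\<And>x y. x \<in> {0..1} \<Longrightarrow> y \<in> {0..1} \<Longrightarrow> \<bar>(D :: nat \<Rightarrow> nat \<Rightarrow> real \<Rightarrow> real \<Rightarrow> real) 0 0 x y\<bar> \<le> L"
      using f s0 by (auto simp: holder2_def)
    have f1: "f x y \<le> 1" if "x \<in> {0..1}" "y \<in> {0..1}" for x y
      using D0[OF that] DL[OF that] L by linarith
    have pk: "prob_space (\<kappa> z)" and sk: "sets (\<kappa> z) = sets unit_square_unif"
      using measurable_space[OF k, of z]
      by (auto simp: space_prob_algebra sets_unit_square_unif sets_borel_pair)
    show ?thesis
    proof (rule prob_space_eqI_le[OF pk U2.prob_space_axioms sk])
      fix A assume A: "A \<in> sets unit_square_unif"
      have "emeasure (\<kappa> z) A \<le> (\<integral>\<^sup>+w. (case w of (x, y) \<Rightarrow> ennreal (f x y) * indicator ({0..1} \<times> {0..1}) (x, y))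
          * indicator A w \<partial>lborel)"
        unfolding \<kappa>z by (rule emeasure_density_le)
      also have "\<dots> \<le> (\<integral>\<^sup>+w. indicator ({0..1} \<times> {0..1}) w * indicator A w \<partial>lborel)"
        using ennreal_leI[OF f1] by (intro nn_integral_mono) (auto simp: indicator_def)
      also have "\<dots> = emeasure unit_square_unif A"
        unfolding unit_square_unif_eq_density using A
        by (subst emeasure_density)
          (auto simp: unit_square_unif_eq_density intro!: borel_measurable_indicator unit_square_cube_measurable)
      finally show "emeasure (\<kappa> z) A \<le> emeasure unit_square_unif A" .
    qed
  qed
  then have "p \<in> P0" using p \<kappa> by (intro P0_if_kernel_uniform[of p \<kappa>]) (auto simp: Q0_def)
  then show False using p by (simp add: Q0_def)
qed

section \<open>The perturbed laws as alternatives, and the resulting bound on the critical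
  radius\<close>

context wave_density
begin

lemma perturbed_law_in_Q0_TV:
  fixes b :: "nat \<Rightarrow> real \<Rightarrow> real" and s :: real
  defines "K \<equiv> strict_floor s"
  assumes gb: "g = b 0" and s: "0 < s" and apos: "0 < a" and var: "0 < (\<integral>t. (g t)\<^sup>2 \<partial>unit_unif)"
    and der: "\<And>j t. j \<le> K \<Longrightarrow> (b j has_real_derivative b (Suc j) t) (at t)"
    and bC: "\<And>j t. j \<le> Suc K \<Longrightarrow> \<bar>b j t\<bar> \<le> C"
    and b_int: "\<And>j i. j \<le> K \<Longrightarrow> b j (of_int i) = 0"
    and bound: "2 * C\<^sup>2 * a * real m powr s \<le> L" and bound0: "K = 0 \<Longrightarrow> 1 + a * C\<^sup>2 \<le> L"
    and boundz: "a * C * real k \<le> L"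
  shows "perturbed_law A \<in> Q0_TV L s"
  unfolding Q0_TV_def
proof (intro CollectI conjI exI[of _ "P.kernel A"] ballI)
  show "perturbed_law A \<in> Q0" using apos var by (rule perturbed_law_in_Q0)
  show "cond_distr (perturbed_law A) XY_of (P.kernel A)" by (rule P.cond_distr_XY)
  fix z z' :: real
  have "\<bar>g t - g u\<bar> \<le> C * \<bar>t - u\<bar>" for t u
    using field_differentiable_bound[of UNIV "b 0" "b (Suc 0)" C t u] der[of 0] bC[of "Suc 0"]
    by (auto simp: gb)
  then have "l1_dist (P.kernel A z) (P.kernel A z') \<le> ennreal (a * C * real k * \<bar>z - z'\<bar>)"
    using b_int[of 0] by (intro l1_dist_kernel_le) (auto simp: gb)
  also have "\<dots> \<le> ennreal (L * \<bar>z - z'\<bar>)"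
    using boundz by (intro ennreal_leI mult_right_mono) auto
  finally show "l1_dist (P.kernel A z) (P.kernel A z') \<le> ennreal (L * \<bar>z - z'\<bar>)" .
next
  fix z :: real
  have "holder2 s L (\<lambda>x y. perturbed A (x, y, z))"
    unfolding gb using s a m abs_sign_of der bC b_int g1 bound bound0 unfolding K_def gb
    by (intro holder2_wave[where C=C]) auto
  then show "\<exists>f. holder2 s L f \<and> (\<forall>x\<in>{0..1}. \<forall>y\<in>{0..1}. 0 \<le> f x y) \<and>
      P.kernel A z = density lborel (\<lambda>(x, y). ennreal (f x y) * indicator ({0..1} \<times> {0..1}) (x, y))"
    using kernel_eq_density[of A z] perturbed_bounds by (intro exI[of _ "\<lambda>x y. perturbed A (x, y, z)"] conjI ballI)
qed

text \<open>The second moment method over all sign patterns on the boxes. The pattern may depend on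
  the test, which suffices because the risk takes a supremum over alternatives.\<close>

lemma exists_perturbation_hard_to_test:
  assumes var: "(\<integral>t. (g t)\<^sup>2 \<partial>unit_unif) \<le> 1" and an: "(real n)\<^sup>2 * a ^ 4 \<le> real m * real m * real k / 16"
    and \<psi>: "\<psi> \<in> tests n"
  shows "\<exists>A. ennreal (1 / 2) \<le> (\<integral>\<^sup>+\<omega>. ennreal (\<psi> \<omega>) \<partial>(\<Pi>\<^sub>M i\<in>{..<n}. unit_cube_unif))
    + (\<integral>\<^sup>+\<omega>. ennreal (1 - \<psi> \<omega>) \<partial>(\<Pi>\<^sub>M i\<in>{..<n}. perturbed_law A))"
proof -
  let ?I = "\<integral>t. (g t)\<^sup>2 \<partial>unit_unif" and ?N = "real m * real m * real k"
  let ?S = "\<lambda>A B. \<Sum>c\<in>cells m k. sign_of A c * sign_of B c"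
  \<comment> \<open>Chosen so that 1 + t <= exp t turns the n-th power of each overlap integral into
    exp of \<open>u\<close> times the overlap of the signs. The number of boxes times
    \<open>u\<^sup>2\<close> is then n^2 a^4 I^6 / (m^2 k), at most 1/16, and exp(1/16) <=
    5/4.\<close>
  define u where "u = real n * (a\<^sup>2 * (?I ^ 3 / ?N))"
  have N: "0 < ?N" using m k by simp
  have I0: "0 \<le> ?I" by (intro integral_nonneg_AE) auto
  have inner: "(\<integral>\<omega>. perturbed A \<omega> * perturbed B \<omega> \<partial>unit_cube_unif) ^ n \<le> exp (u * ?S A B)" for A B
  proof -
    have "(\<integral>\<omega>. perturbed A \<omega> * perturbed B \<omega> \<partial>unit_cube_unif) = 1 + a\<^sup>2 * (?I ^ 3 / ?N) * ?S A B"
      unfolding integral_perturbed_mult integral_wave_mult by (simp add: power2_eq_square mult_ac)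
    also have "\<dots> \<le> exp (a\<^sup>2 * (?I ^ 3 / ?N) * ?S A B)" by (rule exp_ge_add_one_self)
    finally have "(\<integral>\<omega>. perturbed A \<omega> * perturbed B \<omega> \<partial>unit_cube_unif) ^ n \<le> exp (a\<^sup>2 * (?I ^ 3 / ?N) * ?S A B) ^ n"
      using perturbed_bounds(1) by (intro power_mono integral_nonneg_AE AE_I2 mult_nonneg_nonneg)
    also have "\<dots> = exp (u * ?S A B)"
      by (simp add: u_def mult_ac flip: exp_of_nat_mult)
    finally show ?thesis .
  qed
  have "u\<^sup>2 * ?N = ((real n)\<^sup>2 * a ^ 4) * ?I ^ 6 / ?N"
    using m k by (simp add: u_def power_mult_distrib power_divide power2_eq_square power4_eq_xxxx eval_nat_numeral field_simps)
  also have "\<dots> \<le> (?N / 16) * 1 / ?N"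
    using an N I0 var by (intro divide_right_mono mult_mono power_le_one) auto
  also have "\<dots> = 1 / 16" using m k by simp
  finally have u: "u\<^sup>2 * real (card (cells m k)) \<le> 1 / 16" by (simp add: card_cells)
  have "exp (u\<^sup>2 * real (card (cells m k))) \<le> exp (1 / 16)" using u by simp
  also have "\<dots> \<le> 5 / 4" using exp_bound[of "1 / 16"] by (simp add: power2_eq_square)
  finally have e: "exp (u\<^sup>2 * real (card (cells m k))) \<le> 5 / 4" .
  have "(\<Sum>A\<in>Pow (cells m k). \<Sum>B\<in>Pow (cells m k). (\<integral>\<omega>. perturbed A \<omega> * perturbed B \<omega> \<partial>unit_cube_unif) ^ n)
      \<le> (\<Sum>A\<in>Pow (cells m k). \<Sum>B\<in>Pow (cells m k). exp (u * ?S A B))"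
    by (intro sum_mono inner)
  also have "\<dots> \<le> exp (u\<^sup>2 * real (card (cells m k))) * (real (card (Pow (cells m k))))\<^sup>2"
    by (rule sum_exp_sign_of_le) simp
  also have "\<dots> \<le> 5 / 4 * (real (card (Pow (cells m k))))\<^sup>2"
    using e by (intro mult_right_mono) auto
  finally have moment: "(\<Sum>A\<in>Pow (cells m k). \<Sum>B\<in>Pow (cells m k).
      (\<integral>\<omega>. perturbed A \<omega> * perturbed B \<omega> \<partial>unit_cube_unif) ^ n) \<le> 5 / 4 * (real (card (Pow (cells m k))))\<^sup>2" .
  have seq: "sets (\<Pi>\<^sub>M i\<in>{..<n}. unit_cube_unif) = sets (\<Pi>\<^sub>M i\<in>{..<n}. (borel :: triple measure))"
    by (intro sets_PiM_cong) (simp_all add: sets_unit_cube_unif sets_borel_triple)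
  have \<psi>m: "\<psi> \<in> borel_measurable (\<Pi>\<^sub>M i\<in>{..<n}. unit_cube_unif)"
    and \<psi>01: "\<And>\<omega>. \<omega> \<in> space (\<Pi>\<^sub>M i\<in>{..<n}. unit_cube_unif) \<Longrightarrow> \<psi> \<omega> \<in> {0..1}"
    using \<psi> sets_eq_imp_space_eq[OF seq] by (auto simp: tests_def measurable_cong_sets[OF seq refl])
  have "\<exists>A\<in>Pow (cells m k). ennreal (1 / 2) \<le> (\<integral>\<^sup>+\<omega>. ennreal (\<psi> \<omega>) \<partial>(\<Pi>\<^sub>M i\<in>{..<n}. unit_cube_unif))
    + (\<integral>\<^sup>+\<omega>. ennreal (1 - \<psi> \<omega>) \<partial>(\<Pi>\<^sub>M i\<in>{..<n}. perturbed_law A))"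
  proof (rule second_moment_lower_bound[OF U3.prob_space_axioms _ _ _ _ _ _ moment \<psi>m \<psi>01])
    show "perturbed A \<omega> \<le> 2" "0 \<le> perturbed A \<omega>" for A \<omega> by (rule perturbed_bounds)+
    show "(\<integral>\<omega>. perturbed A \<omega> \<partial>unit_cube_unif) = 1" for A by (rule integral_perturbed)
    show "perturbed A \<in> borel_measurable unit_cube_unif" for A by measurable
  qed auto
  then show ?thesis by blast
qed

text \<open>At any radius below the separation, every perturbed law still counts as an alternative,
  so the risk is at least 1/2 and exceeds the threshold 1/3.\<close>

lemma critical_radius_ge:
  assumes var: "(\<integral>t. (g t)\<^sup>2 \<partial>unit_unif) \<le> 1" and an: "(real n)\<^sup>2 * a ^ 4 \<le> real m * real m * real k / 16"
    and H0: "unit_cube_unif \<in> H0" and H1: "\<And>A. perturbed_law A \<in> H1"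
  shows "ennreal (a * (\<integral>t. (g t)\<^sup>2 \<partial>unit_unif) ^ 3 / 4) \<le> critical_radius n H0 P0 H1"
  unfolding critical_radius_def
proof (rule Inf_greatest, rule ccontr)
  fix \<epsilon> assume "\<epsilon> \<in> {\<epsilon>. minimax_risk n H0 P0 H1 \<epsilon> \<le> 1 / 3}"
  then have risk: "minimax_risk n H0 P0 H1 \<epsilon> \<le> 1 / 3" by simp
  assume "\<not> ennreal (a * (\<integral>t. (g t)\<^sup>2 \<partial>unit_unif) ^ 3 / 4) \<le> \<epsilon>"
  then have \<epsilon>: "\<epsilon> \<le> ennreal (a * (\<integral>t. (g t)\<^sup>2 \<partial>unit_unif) ^ 3 / 4)" by simp
  have S1: "perturbed_law A \<in> S1 P0 H1 \<epsilon>" for A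
    unfolding S1_def using H1 order_trans[OF \<epsilon> l1_dist_perturbed_ge] by (auto intro!: INF_greatest)
  have "ennreal (1 / 2) \<le> minimax_risk n H0 P0 H1 \<epsilon>"
    unfolding minimax_risk_def
  proof (rule INF_greatest)
    fix \<psi> assume \<psi>: "\<psi> \<in> tests n"
    obtain A where "ennreal (1 / 2) \<le> (\<integral>\<^sup>+\<omega>. ennreal (\<psi> \<omega>) \<partial>(\<Pi>\<^sub>M i\<in>{..<n}. unit_cube_unif))
        + (\<integral>\<^sup>+\<omega>. ennreal (1 - \<psi> \<omega>) \<partial>(\<Pi>\<^sub>M i\<in>{..<n}. perturbed_law A))"
      using exists_perturbation_hard_to_test[OF var an \<psi>] by blast
    also have "\<dots> \<le> (SUP p\<in>H0. \<integral>\<^sup>+\<omega>. ennreal (\<psi> \<omega>) \<partial>(\<Pi>\<^sub>M i\<in>{..<n}. p)) +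
        (SUP p\<in>S1 P0 H1 \<epsilon>. \<integral>\<^sup>+\<omega>. ennreal (1 - \<psi> \<omega>) \<partial>(\<Pi>\<^sub>M i\<in>{..<n}. p))"
      by (intro add_mono SUP_upper2[OF H0] SUP_upper2[OF S1[of A]] order_refl)
    finally show "ennreal (1 / 2) \<le> (SUP p\<in>H0. \<integral>\<^sup>+\<omega>. ennreal (\<psi> \<omega>) \<partial>(\<Pi>\<^sub>M i\<in>{..<n}. p)) +
        (SUP p\<in>S1 P0 H1 \<epsilon>. \<integral>\<^sup>+\<omega>. ennreal (1 - \<psi> \<omega>) \<partial>(\<Pi>\<^sub>M i\<in>{..<n}. p))" .
  qed
  also note risk
  also have "(1 / 3 :: ennreal) = ennreal (1 / 3)"
    using divide_ennreal[of 1 3] by simp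
  finally have "(1 / 2 :: real) \<le> 1 / 3" by (subst (asm) ennreal_le_iff) auto
  then show False by simp
qed

end

section \<open>Choice of amplitude and of box sizes\<close>

lemma nat_between_double:
  fixes x :: real
  assumes "1 \<le> x"
  obtains N :: nat where "0 < N" "x \<le> real N" "real N \<le> 2 * x"
proof
  show "0 < nat \<lceil>x\<rceil>" "x \<le> real (nat \<lceil>x\<rceil>)" "real (nat \<lceil>x\<rceil>) \<le> 2 * x"
    using assms by linarith+
qed

theorem theorem4p2:
  fixes s L :: real and H0 :: "triple measure set"
  assumes "0 < s" and "0 < L"
    and "H0 = P0_TV L \<or> H0 = P0_chi2 L"
    and "Q0_TV L s \<noteq> {}"
  shows "\<exists>c0::real. 0 < c0 \<and> (\<forall>n\<ge>1.
           ennreal (c0 / real n powr (2 * s / (5 * s + 2)))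
             \<le> critical_radius n H0 P0 (Q0_TV L s))"
proof -
  define K where "K = strict_floor s"
  obtain b C where der: "\<And>k t. k \<le> K \<Longrightarrow> (b k has_real_derivative b (Suc k) t) (at t)"
    and bC: "\<And>k t. k \<le> Suc K \<Longrightarrow> \<bar>b k t\<bar> \<le> C"
    and b_int: "\<And>k i. k \<le> K \<Longrightarrow> b k (of_int i) = 0"
    and per: "\<And>t i. b 0 (t + of_int i) = b 0 t"
    and b1: "\<And>t. \<bar>b 0 t\<bar> \<le> 1"
    and mean: "(\<integral>t. b 0 t * indicator {0..1} t \<partial>lborel) = 0"
    and var: "0 < (\<integral>t. (b 0 t)\<^sup>2 * indicator {0..1} t \<partial>lborel)"
    by (rule bump_family[of K]) (rule that)
  have C0: "0 \<le> C" using bC[of 0 0] by auto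
  have "continuous_on UNIV (b 0)"
    using der[of 0] by (intro continuous_at_imp_continuous_on) (auto intro: DERIV_isCont)
  then have meas [measurable]: "b 0 \<in> borel_measurable borel" by (rule borel_measurable_continuous_onI)
  have mean': "(\<integral>t. b 0 t \<partial>unit_unif) = 0" and var': "0 < (\<integral>t. (b 0 t)\<^sup>2 \<partial>unit_unif)"
    using mean var by (simp_all add: integral_unit_unif)
  define I where "I = (\<integral>t. (b 0 t)\<^sup>2 \<partial>unit_unif)"
  have "(\<integral>t. (b 0 t)\<^sup>2 \<partial>unit_unif) \<le> (\<integral>t. 1 \<partial>unit_unif)"
    using b1 by (intro integral_mono U.integrable_const_bound[of _ 1]) (auto simp: abs_square_le_1)
  then have I1: "I \<le> 1" by (simp add: I_def U.prob_space[simplified])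
  \<comment> \<open>The bound 1/2 makes c^4 <= 1/16 for the second moment, the second term secures
    the Hoelder and Lipschitz conditions, and the third keeps 1 + c C^2 <= L when the density itself
    is bounded by \<open>L\<close>. The added 1 in each denominator avoids division by zero.\<close>
  define c where "c = min (1 / 2) (min (L / (2 * C\<^sup>2 * 2 powr s + 2 * C + 1))
      (if K = 0 then (L - 1) / (C\<^sup>2 + 1) else 1))"
  have den: "0 < 2 * C\<^sup>2 * 2 powr s + 2 * C + 1" "0 < C\<^sup>2 + 1"
    using C0 by (auto intro!: add_nonneg_pos)
  have "0 < c"
    using den assms(2) Q0_TV_nonempty_imp[OF assms(4)] by (auto simp: c_def K_def)
  moreover have "c \<le> 1 / 2" unfolding c_def by (rule min.cobounded1)
  ultimately have c: "0 < c" "c \<le> 1 / 2" by auto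
  have "c \<le> L / (2 * C\<^sup>2 * 2 powr s + 2 * C + 1)" by (simp add: c_def)
  then have cL: "c * (2 * C\<^sup>2 * 2 powr s) + c * (2 * C) + c \<le> L"
    using den by (simp add: pos_le_divide_eq algebra_simps)
  have "0 \<le> c * (2 * C\<^sup>2 * 2 powr s)" "0 \<le> c * (2 * C)" using c C0 by auto
  with cL c have cL1: "c * (2 * C\<^sup>2 * 2 powr s) \<le> L" and cL2: "c * (2 * C) \<le> L" by linarith+
  have cL0: "1 + c * C\<^sup>2 \<le> L" if "K = 0"
  proof -
    have "c \<le> (L - 1) / (C\<^sup>2 + 1)" using that by (simp add: c_def)
    then have "c * C\<^sup>2 + c \<le> L - 1" using den by (simp add: pos_le_divide_eq algebra_simps)
    then show ?thesis using c by linarith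
  qed
  have "unit_cube_unif \<in> H0"
    using assms(3) unit_cube_unif_in_P0_TV unit_cube_unif_in_P0_chi2 by auto
  have main: "ennreal (c * I ^ 3 / 4 / real n powr (2 * s / (5 * s + 2))) \<le> critical_radius n H0 P0 (Q0_TV L s)"
    if n: "1 \<le> n" for n
  proof -
    \<comment> \<open>\<open>x\<close> and \<open>y\<close> are the ideal values of k and m. They
      balance three constraints with a = c / x: a k of order 1, a m^s of order 1 because
      \<open>y powr s = x\<close>, and n^2 a^4 of order m^2 k because y^2 x^5 = n^2.\<close>
    define x where "x = real n powr (2 * s / (5 * s + 2))"
    define y where "y = real n powr (2 / (5 * s + 2))"
    have xy: "1 \<le> x" "1 \<le> y"
      unfolding x_def y_def using n assms(1) by (auto intro!: ge_one_powr_ge_zero)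
    obtain k where k: "0 < k" "x \<le> real k" "real k \<le> 2 * x" using nat_between_double[OF xy(1)] .
    obtain m where m: "0 < m" "y \<le> real m" "real m \<le> 2 * y" using nat_between_double[OF xy(2)] .
    have ys: "y powr s = x" by (simp add: x_def y_def powr_powr mult.commute)
    have n2: "(real n)\<^sup>2 = y * y * x * x ^ 4"
    proof -
      have pos: "0 < 5 * s + 2" using assms(1) by simp
      have exponent: "2 / q + 2 / q + 2 * s / q + 4 * (2 * s / q) = 2 * (5 * s + 2) / q" for q :: real
        by (cases "q = 0") (simp_all add: field_simps)
      have x4: "x ^ 4 = real n powr (4 * (2 * s / (5 * s + 2)))"
        using n by (simp add: x_def powr_power)
      have "y * y * x * x ^ 4 = real n powr (2 / (5 * s + 2) + 2 / (5 * s + 2) + 2 * s / (5 * s + 2) + 4 * (2 * s / (5 * s + 2)))"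
        unfolding x4 powr_add by (simp only: x_def y_def)
      also have "2 / (5 * s + 2) + 2 / (5 * s + 2) + 2 * s / (5 * s + 2) + 4 * (2 * s / (5 * s + 2)) = real 2"
        unfolding exponent using pos by (subst nonzero_mult_div_cancel_right) auto
      also have "real n powr real 2 = (real n)\<^sup>2" using n by (intro powr_realpow) simp
      finally show ?thesis by simp
    qed
    define a where "a = c / x"
    have a: "0 < a" "a \<le> c" "a * x = c" using c xy by (auto simp: a_def divide_le_eq_1 field_simps)
    interpret W: wave_density "b 0" m k a
      using meas b1 per mean' m k a c by unfold_locales auto
    have an: "(real n)\<^sup>2 * a ^ 4 \<le> real m * real m * real k / 16"
    proof -
      have "(real n)\<^sup>2 * a ^ 4 = y * y * x * (a * x) ^ 4" by (simp add: n2 power_mult_distrib mult_ac)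
      also have "\<dots> \<le> real m * real m * real k * (1 / 2) ^ 4"
        unfolding a(3) using m k xy c by (intro mult_mono power_mono) auto
      finally show ?thesis by (simp add: power4_eq_xxxx)
    qed
    \<comment> \<open>Rounding up to an integer at most doubles \<open>y\<close>; the loss is the
      factor 2^s already built into \<open>c\<close>.\<close>
    have "real m powr s \<le> (2 * y) powr s" using m assms(1) by (intro powr_mono2) auto
    also have "\<dots> = 2 powr s * x" using xy by (simp add: powr_mult ys)
    finally have "2 * C\<^sup>2 * a * real m powr s \<le> 2 * C\<^sup>2 * a * (2 powr s * x)"
      using a by (intro mult_left_mono) auto
    also have "\<dots> = (a * x) * (2 * C\<^sup>2 * 2 powr s)" by (simp add: mult_ac)
    finally have bound: "2 * C\<^sup>2 * a * real m powr s \<le> L" using cL1 by (simp add: a(3))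
    have "a * C * real k \<le> a * C * (2 * x)" using a C0 k by (intro mult_left_mono) auto
    also have "\<dots> = (a * x) * (2 * C)" by (simp add: mult_ac)
    finally have boundz: "a * C * real k \<le> L" using cL2 by (simp add: a(3))
    have bound0: "1 + a * C\<^sup>2 \<le> L" if "K = 0"
      using cL0[OF that] mult_right_mono[OF a(2), of "C\<^sup>2"] by simp
    have "W.perturbed_law A \<in> Q0_TV L s" for A
      using assms(1) a(1) var' der bC b_int bound bound0 boundz unfolding K_def
      by (intro W.perturbed_law_in_Q0_TV[of b]) auto
    then have "ennreal (a * I ^ 3 / 4) \<le> critical_radius n H0 P0 (Q0_TV L s)"
      unfolding I_def using I1[unfolded I_def] an \<open>unit_cube_unif \<in> H0\<close> by (intro W.critical_radius_ge)
    moreover have "a * I ^ 3 / 4 = c * I ^ 3 / 4 / x" by (simp add: a_def)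
    ultimately show ?thesis by (simp add: x_def)
  qed
  have "0 < c * I ^ 3 / 4" using c var' by (simp add: I_def)
  then show ?thesis using main by blast
qed

end
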